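(* Let $(\mathcal C,\otimes,I,\gamma)$ be a symmetric monoidal category and $(\mathcal T,\eta,\mu,\tau)$ a strong monad on it. The following are equivalent: (1) for every object $X$ of $\mathcal C$, $\mathcal T$ admits a terminal central cone at $X$; (2) there exists a commutative strong submonad $\mathcal Z$ of $\mathcal T$, with submonad monomorphism $\iota:\mathcal Z\Rightarrow\mathcal T$, such that the canonical embedding $\mathcal I:\mathcal C_{\mathcal Z}\to\mathcal C_{\mathcal T}$ ($\mathcal I(X)=X$, $\mathcal I(f:X\to\mathcal ZY)=\iota_Y\circ f$) corestricts to an isomorphism of categories $\mathcal C_{\mathcal Z}\cong Z(\mathcal C_{\mathcal T})$; (3) the corestriction $\hat{\mathcal J}:\mathcal C\to Z(\mathcal C_{\mathcal T})$ of the Kleisli left adjoint $\mathcal J:\mathcal C\to\mathcal C_{\mathcal T}$ to the premonoidal centre is a left adjoint.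
   Context: Right strength: $\tau'_{X,Y}=\mathcal T(\gamma_{Y,X})\circ\tau_{Y,X}\circ\gamma_{\mathcal TX,Y}$. A strong monad is commutative if $\mu_{X\otimes Y}\circ\mathcal T\tau'_{X,Y}\circ\tau_{\mathcal TX,Y}=\mu_{X\otimes Y}\circ\mathcal T\tau_{X,Y}\circ\tau'_{X,\mathcal TY}$ for all $X,Y$. A central cone of $\mathcal T$ at $X$ is a pair $(Z,\iota)$ with $\iota:Z\to\mathcal TX$ such that for every object $Y$, $\mu_{X\otimes Y}\circ\mathcal T\tau'_{X,Y}\circ\tau_{\mathcal TX,Y}\circ(\iota\otimes\mathrm{id}_{\mathcal TY})=\mu_{X\otimes Y}\circ\mathcal T\tau_{X,Y}\circ\tau'_{X,\mathcal TY}\circ(\iota\otimes\mathrm{id}_{\mathcal TY})$; morphisms of central cones $(Z',\iota')\to(Z,\iota)$ are $\varphi:Z'\to Z$ with $\iota\circ\varphi=\iota'$; a terminal central cone is a terminal object of this category. A strong submonad of $\mathcal T$ is a strong monad $\mathcal Z$ with a monomorphism of strong monads $\iota:\mathcal Z\Rightarrow\mathcal T$ (natural transformation with $\iota\circ\eta^{\mathcal Z}=\eta^{\mathcal T}$, $\iota\circ\mu^{\mathcal Z}=\mu^{\mathcal T}\circ\mathcal T\iota\circ\iota_{\mathcal Z}$, $\iota_{X\otimes Y}\circ\tau^{\mathcal Z}_{X,Y}=\tau^{\mathcal T}_{X,Y}\circ(X\otimes\iota_Y)$). Kleisli category $\mathcal C_{\mathcal T}$: morphisms $X\to Y$ are morphisms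 $X\to\mathcal TY$, composition $g\odot f=\mu\circ\mathcal Tg\circ f$, identities $\eta$; the Kleisli left adjoint $\mathcal J$ is the identity on objects and sends $f$ to $\eta\circ f$. For $f:X\to\mathcal TY$ and object $W$: $f\otimes_l W=\tau'_{Y,W}\circ(f\otimes W)$, $W\otimes_r f=\tau_{W,Y}\circ(W\otimes f)$. A Kleisli morphism $f:X\to\mathcal TY$ is central if for all $f':X'\to\mathcal TY'$, $(Y\otimes_r f')\odot(f\otimes_l X')=(f\otimes_l Y')\odot(X\otimes_r f')$; $Z(\mathcal C_{\mathcal T})$ is the subcategory with all objects and central morphisms. Every morphism $\eta\circ f$ is central, so $\mathcal J$ corestricts to $\hat{\mathcal J}:\mathcal C\to Z(\mathcal C_{\mathcal T})$. *)

theory Defs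
  imports Main
begin

section \<open>Categories, functors, adjunctions\<close>

text \<open>The operations are total functions; the axioms only constrain them on the carriers
  \<open>Obj\<close> and \<open>Arr\<close>, and composition only on composable pairs.\<close>

record ('o, 'a) cat =
  Obj :: "'o set"
  Arr :: "'a set"
  Dom :: "'a \<Rightarrow> 'o"
  Cod :: "'a \<Rightarrow> 'o"
  Ident :: "'o \<Rightarrow> 'a" ("\<one>\<index>")
  Comp :: "'a \<Rightarrow> 'a \<Rightarrow> 'a" (infixr "\<cdot>\<index>" 55)

definition hom :: "('o, 'a, 'm) cat_scheme \<Rightarrow> 'o \<Rightarrow> 'o \<Rightarrow> 'a set" where
  "hom C X Y = {f \<in> Arr C. Dom C f = X \<and> Cod C f = Y}"

locale category =
  fixes C :: "('o, 'a, 'm) cat_scheme" (structure)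
  assumes Dom_Obj: "f \<in> Arr C \<Longrightarrow> Dom C f \<in> Obj C"
    and Cod_Obj: "f \<in> Arr C \<Longrightarrow> Cod C f \<in> Obj C"
    and Ident_hom: "X \<in> Obj C \<Longrightarrow> \<one> X \<in> hom C X X"
    and Comp_hom: "f \<in> hom C X Y \<Longrightarrow> g \<in> hom C Y Z \<Longrightarrow> g \<cdot> f \<in> hom C X Z"
    and Comp_Ident_right: "f \<in> hom C X Y \<Longrightarrow> f \<cdot> \<one> X = f"
    and Comp_Ident_left: "f \<in> hom C X Y \<Longrightarrow> \<one> Y \<cdot> f = f"
    and Comp_assoc:
      "f \<in> hom C W X \<Longrightarrow> g \<in> hom C X Y \<Longrightarrow> h \<in> hom C Y Z \<Longrightarrow> (h \<cdot> g) \<cdot> f = h \<cdot> (g \<cdot> f)"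

definition iso_arr :: "('o, 'a, 'm) cat_scheme \<Rightarrow> 'o \<Rightarrow> 'o \<Rightarrow> 'a \<Rightarrow> bool" where
  "iso_arr C X Y f \<longleftrightarrow> f \<in> hom C X Y \<and> (\<exists>g \<in> hom C Y X. g \<cdot> f = \<one> X \<and> f \<cdot> g = \<one> Y)"
  for C (structure)

definition terminal :: "('o, 'a, 'm) cat_scheme \<Rightarrow> 'o \<Rightarrow> bool" where
  "terminal C t \<longleftrightarrow> t \<in> Obj C \<and> (\<forall>X \<in> Obj C. \<exists>!f. f \<in> hom C X t)"

record ('o, 'a, 'p, 'b) func =
  fobj :: "'o \<Rightarrow> 'p"
  farr :: "'a \<Rightarrow> 'b"

locale cat_functor =
  dom: category C + cod: category D
  for C :: "('o, 'a, 'm) cat_scheme" and D :: "('p, 'b, 'n) cat_scheme"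
    and F :: "('o, 'a, 'p, 'b, 'k) func_scheme" +
  assumes fobj_Obj: "X \<in> Obj C \<Longrightarrow> fobj F X \<in> Obj D"
    and farr_hom: "f \<in> hom C X Y \<Longrightarrow> farr F f \<in> hom D (fobj F X) (fobj F Y)"
    and farr_Ident: "X \<in> Obj C \<Longrightarrow> farr F (\<one>\<^bsub>C\<^esub> X) = \<one>\<^bsub>D\<^esub> (fobj F X)"
    and farr_Comp: "f \<in> hom C X Y \<Longrightarrow> g \<in> hom C Y Z \<Longrightarrow>
      farr F (g \<cdot>\<^bsub>C\<^esub> f) = farr F g \<cdot>\<^bsub>D\<^esub> farr F f"

definition id_func :: "('o, 'a, 'o, 'a) func" where
  "id_func = \<lparr>fobj = (\<lambda>X. X), farr = (\<lambda>f. f)\<rparr>"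

definition comp_func ::
  "('p, 'b, 'q, 'c, 'k) func_scheme \<Rightarrow> ('o, 'a, 'p, 'b, 'l) func_scheme \<Rightarrow> ('o, 'a, 'q, 'c) func"
  where
  "comp_func G F = \<lparr>fobj = (\<lambda>X. fobj G (fobj F X)), farr = (\<lambda>f. farr G (farr F f))\<rparr>"

locale nat_trans =
  source: cat_functor C D F + target: cat_functor C D G
  for C :: "('o, 'a, 'm) cat_scheme" and D :: "('p, 'b, 'n) cat_scheme"
    and F :: "('o, 'a, 'p, 'b, 'k) func_scheme" and G :: "('o, 'a, 'p, 'b, 'l) func_scheme"
    and \<theta> :: "'o \<Rightarrow> 'b" +
  assumes component_hom: "X \<in> Obj C \<Longrightarrow> \<theta> X \<in> hom D (fobj F X) (fobj G X)"
    and naturality: "f \<in> hom C X Y \<Longrightarrow> \<theta> Y \<cdot>\<^bsub>D\<^esub> farr F f = farr G f \<cdot>\<^bsub>D\<^esub> \<theta> X"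

definition iso_functor ::
  "('o, 'a, 'm) cat_scheme \<Rightarrow> ('p, 'b, 'n) cat_scheme \<Rightarrow> ('o, 'a, 'p, 'b) func \<Rightarrow> bool" where
  "iso_functor C D F \<longleftrightarrow> cat_functor C D F \<and>
     (\<exists>G :: ('p, 'b, 'o, 'a) func. cat_functor D C G \<and>
        (\<forall>X \<in> Obj C. fobj G (fobj F X) = X) \<and> (\<forall>f \<in> Arr C. farr G (farr F f) = f) \<and>
        (\<forall>Y \<in> Obj D. fobj F (fobj G Y) = Y) \<and> (\<forall>g \<in> Arr D. farr F (farr G g) = g))"

locale adjunction =
  unit: nat_trans C C id_func "comp_func G F" \<eta> +
  counit: nat_trans D D "comp_func F G" id_func \<epsilon> +
  left: cat_functor C D F + right: cat_functor D C G
  for C :: "('o, 'a, 'm) cat_scheme" and D :: "('p, 'b, 'n) cat_scheme"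
    and F :: "('o, 'a, 'p, 'b) func" and G :: "('p, 'b, 'o, 'a) func"
    and \<eta> :: "'o \<Rightarrow> 'a" and \<epsilon> :: "'p \<Rightarrow> 'b" +
  assumes triangle_left:
      "X \<in> Obj C \<Longrightarrow> \<epsilon> (fobj F X) \<cdot>\<^bsub>D\<^esub> farr F (\<eta> X) = \<one>\<^bsub>D\<^esub> (fobj F X)"
    and triangle_right:
      "Y \<in> Obj D \<Longrightarrow> farr G (\<epsilon> Y) \<cdot>\<^bsub>C\<^esub> \<eta> (fobj G Y) = \<one>\<^bsub>C\<^esub> (fobj G Y)"

definition left_adjoint ::
  "('o, 'a, 'm) cat_scheme \<Rightarrow> ('p, 'b, 'n) cat_scheme \<Rightarrow> ('o, 'a, 'p, 'b) func \<Rightarrow> bool" where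
  "left_adjoint C D F \<longleftrightarrow> (\<exists>G \<eta> \<epsilon>. adjunction C D F G \<eta> \<epsilon>)"


section \<open>Symmetric monoidal categories\<close>

text \<open>\<open>\<otimes>\<close> is the tensor product of objects and \<open>\<boxtimes>\<close> that of arrows.\<close>

record ('o, 'a) smc = "('o, 'a) cat" +
  Tobj :: "'o \<Rightarrow> 'o \<Rightarrow> 'o" (infixr "\<otimes>\<index>" 70)
  Tarr :: "'a \<Rightarrow> 'a \<Rightarrow> 'a" (infixr "\<boxtimes>\<index>" 70)
  Unit :: "'o" ("\<I>\<index>")
  Assoc :: "'o \<Rightarrow> 'o \<Rightarrow> 'o \<Rightarrow> 'a" ("\<alpha>\<index>")
  Lunit :: "'o \<Rightarrow> 'a" ("\<l>\<index>")
  Runit :: "'o \<Rightarrow> 'a" ("\<r>\<index>")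
  Sym :: "'o \<Rightarrow> 'o \<Rightarrow> 'a" ("\<gamma>\<index>")

locale symmetric_monoidal_category = category C
  for C :: "('o, 'a, 'm) smc_scheme" (structure) +
  assumes Tobj_Obj: "X \<in> Obj C \<Longrightarrow> Y \<in> Obj C \<Longrightarrow> X \<otimes> Y \<in> Obj C"
    and Tarr_hom: "f \<in> hom C X X' \<Longrightarrow> g \<in> hom C Y Y' \<Longrightarrow> f \<boxtimes> g \<in> hom C (X \<otimes> Y) (X' \<otimes> Y')"
    and Tarr_Ident: "X \<in> Obj C \<Longrightarrow> Y \<in> Obj C \<Longrightarrow> \<one> X \<boxtimes> \<one> Y = \<one> (X \<otimes> Y)"
    and Tarr_Comp: "f \<in> hom C X X' \<Longrightarrow> f' \<in> hom C X' X'' \<Longrightarrow> g \<in> hom C Y Y' \<Longrightarrow> g' \<in> hom C Y' Y'' \<Longrightarrow>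
      (f' \<cdot> f) \<boxtimes> (g' \<cdot> g) = (f' \<boxtimes> g') \<cdot> (f \<boxtimes> g)"
    and Unit_Obj: "\<I> \<in> Obj C"
    and Assoc_iso: "X \<in> Obj C \<Longrightarrow> Y \<in> Obj C \<Longrightarrow> Z \<in> Obj C \<Longrightarrow>
      iso_arr C ((X \<otimes> Y) \<otimes> Z) (X \<otimes> (Y \<otimes> Z)) (\<alpha> X Y Z)"
    and Assoc_nat: "f \<in> hom C X X' \<Longrightarrow> g \<in> hom C Y Y' \<Longrightarrow> h \<in> hom C Z Z' \<Longrightarrow>
      \<alpha> X' Y' Z' \<cdot> ((f \<boxtimes> g) \<boxtimes> h) = (f \<boxtimes> (g \<boxtimes> h)) \<cdot> \<alpha> X Y Z"
    and Lunit_iso: "X \<in> Obj C \<Longrightarrow> iso_arr C (\<I> \<otimes> X) X (\<l> X)"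
    and Lunit_nat: "f \<in> hom C X X' \<Longrightarrow> \<l> X' \<cdot> (\<one> \<I> \<boxtimes> f) = f \<cdot> \<l> X"
    and Runit_iso: "X \<in> Obj C \<Longrightarrow> iso_arr C (X \<otimes> \<I>) X (\<r> X)"
    and Runit_nat: "f \<in> hom C X X' \<Longrightarrow> \<r> X' \<cdot> (f \<boxtimes> \<one> \<I>) = f \<cdot> \<r> X"
    and pentagon: "W \<in> Obj C \<Longrightarrow> X \<in> Obj C \<Longrightarrow> Y \<in> Obj C \<Longrightarrow> Z \<in> Obj C \<Longrightarrow>
      (\<one> W \<boxtimes> \<alpha> X Y Z) \<cdot> \<alpha> W (X \<otimes> Y) Z \<cdot> (\<alpha> W X Y \<boxtimes> \<one> Z) = \<alpha> W X (Y \<otimes> Z) \<cdot> \<alpha> (W \<otimes> X) Y Z"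
    and triangle: "X \<in> Obj C \<Longrightarrow> Y \<in> Obj C \<Longrightarrow> (\<one> X \<boxtimes> \<l> Y) \<cdot> \<alpha> X \<I> Y = \<r> X \<boxtimes> \<one> Y"
    and Sym_hom: "X \<in> Obj C \<Longrightarrow> Y \<in> Obj C \<Longrightarrow> \<gamma> X Y \<in> hom C (X \<otimes> Y) (Y \<otimes> X)"
    and Sym_nat: "f \<in> hom C X X' \<Longrightarrow> g \<in> hom C Y Y' \<Longrightarrow> \<gamma> X' Y' \<cdot> (f \<boxtimes> g) = (g \<boxtimes> f) \<cdot> \<gamma> X Y"
    and Sym_Sym: "X \<in> Obj C \<Longrightarrow> Y \<in> Obj C \<Longrightarrow> \<gamma> Y X \<cdot> \<gamma> X Y = \<one> (X \<otimes> Y)"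
    and Sym_Unit: "X \<in> Obj C \<Longrightarrow> \<l> X \<cdot> \<gamma> X \<I> = \<r> X"
    and hexagon: "X \<in> Obj C \<Longrightarrow> Y \<in> Obj C \<Longrightarrow> Z \<in> Obj C \<Longrightarrow>
      \<alpha> Y Z X \<cdot> \<gamma> X (Y \<otimes> Z) \<cdot> \<alpha> X Y Z = (\<one> Y \<boxtimes> \<gamma> X Z) \<cdot> \<alpha> Y X Z \<cdot> (\<gamma> X Y \<boxtimes> \<one> Z)"


section \<open>Strong monads\<close>

record ('o, 'a) smonad = "('o, 'a, 'o, 'a) func" +
  eta :: "'o \<Rightarrow> 'a"
  mu :: "'o \<Rightarrow> 'a"
  str :: "'o \<Rightarrow> 'o \<Rightarrow> 'a"

locale strong_monad =
  symmetric_monoidal_category C +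
  unit: nat_trans C C id_func T "eta T" +
  mult: nat_trans C C "comp_func T T" T "mu T"
  for C :: "('o, 'a, 'm) smc_scheme" (structure) and T :: "('o, 'a) smonad" +
  assumes mu_eta_left: "X \<in> Obj C \<Longrightarrow> mu T X \<cdot> eta T (fobj T X) = \<one> (fobj T X)"
    and mu_eta_right: "X \<in> Obj C \<Longrightarrow> mu T X \<cdot> farr T (eta T X) = \<one> (fobj T X)"
    and mu_mu: "X \<in> Obj C \<Longrightarrow> mu T X \<cdot> mu T (fobj T X) = mu T X \<cdot> farr T (mu T X)"
    and str_hom: "X \<in> Obj C \<Longrightarrow> Y \<in> Obj C \<Longrightarrow> str T X Y \<in> hom C (X \<otimes> fobj T Y) (fobj T (X \<otimes> Y))"
    and str_nat: "f \<in> hom C X X' \<Longrightarrow> g \<in> hom C Y Y' \<Longrightarrow>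
      str T X' Y' \<cdot> (f \<boxtimes> farr T g) = farr T (f \<boxtimes> g) \<cdot> str T X Y"
    and str_Lunit: "X \<in> Obj C \<Longrightarrow> farr T (\<l> X) \<cdot> str T \<I> X = \<l> (fobj T X)"
    and str_Assoc: "X \<in> Obj C \<Longrightarrow> Y \<in> Obj C \<Longrightarrow> Z \<in> Obj C \<Longrightarrow>
      farr T (\<alpha> X Y Z) \<cdot> str T (X \<otimes> Y) Z
        = str T X (Y \<otimes> Z) \<cdot> (\<one> X \<boxtimes> str T Y Z) \<cdot> \<alpha> X Y (fobj T Z)"
    and str_eta: "X \<in> Obj C \<Longrightarrow> Y \<in> Obj C \<Longrightarrow> str T X Y \<cdot> (\<one> X \<boxtimes> eta T Y) = eta T (X \<otimes> Y)"
    and str_mu: "X \<in> Obj C \<Longrightarrow> Y \<in> Obj C \<Longrightarrow>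
      str T X Y \<cdot> (\<one> X \<boxtimes> mu T Y) = mu T (X \<otimes> Y) \<cdot> farr T (str T X Y) \<cdot> str T X (fobj T Y)"

definition rstr :: "('o, 'a, 'm) smc_scheme \<Rightarrow> ('o, 'a) smonad \<Rightarrow> 'o \<Rightarrow> 'o \<Rightarrow> 'a" where
  "rstr C T X Y = farr T (\<gamma> Y X) \<cdot> str T Y X \<cdot> \<gamma> (fobj T X) Y"
  for C (structure)

definition commutative :: "('o, 'a, 'm) smc_scheme \<Rightarrow> ('o, 'a) smonad \<Rightarrow> bool" where
  "commutative C T \<longleftrightarrow> (\<forall>X \<in> Obj C. \<forall>Y \<in> Obj C.
     mu T (X \<otimes> Y) \<cdot> farr T (rstr C T X Y) \<cdot> str T (fobj T X) Y
       = mu T (X \<otimes> Y) \<cdot> farr T (str T X Y) \<cdot> rstr C T X (fobj T Y))"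
  for C (structure)

locale strong_monad_morphism =
  source: strong_monad C S + target: strong_monad C T + nat_trans C C S T \<iota>
  for C :: "('o, 'a, 'm) smc_scheme" (structure) and S T :: "('o, 'a) smonad"
    and \<iota> :: "'o \<Rightarrow> 'a" +
  assumes morphism_eta: "X \<in> Obj C \<Longrightarrow> \<iota> X \<cdot> eta S X = eta T X"
    and morphism_mu:
      "X \<in> Obj C \<Longrightarrow> \<iota> X \<cdot> mu S X = mu T X \<cdot> farr T (\<iota> X) \<cdot> \<iota> (fobj S X)"
    and morphism_str: "X \<in> Obj C \<Longrightarrow> Y \<in> Obj C \<Longrightarrow>
      \<iota> (X \<otimes> Y) \<cdot> str S X Y = str T X Y \<cdot> (\<one> X \<boxtimes> \<iota> Y)"

text \<open>The morphism is required to be a monomorphism in the category of strong monads on \<open>C\<close>.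
  Morphisms of strong monads are identified when their components at the objects of \<open>C\<close> agree.\<close>

definition strong_submonad ::
  "('o, 'a, 'm) smc_scheme \<Rightarrow> ('o, 'a) smonad \<Rightarrow> ('o, 'a) smonad \<Rightarrow> ('o \<Rightarrow> 'a) \<Rightarrow> bool" where
  "strong_submonad C T S \<iota> \<longleftrightarrow> strong_monad_morphism C S T \<iota> \<and>
     (\<forall>R \<kappa> \<kappa>'. strong_monad_morphism C R S \<kappa> \<and> strong_monad_morphism C R S \<kappa>' \<and>
        (\<forall>X \<in> Obj C. \<iota> X \<cdot> \<kappa> X = \<iota> X \<cdot> \<kappa>' X) \<longrightarrow> (\<forall>X \<in> Obj C. \<kappa> X = \<kappa>' X))"
  for C (structure)


section \<open>Central cones\<close>

definition central_cone ::
  "('o, 'a, 'm) smc_scheme \<Rightarrow> ('o, 'a) smonad \<Rightarrow> 'o \<Rightarrow> 'o \<times> 'a \<Rightarrow> bool" where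
  "central_cone C T X = (\<lambda>(Z, \<iota>). Z \<in> Obj C \<and> \<iota> \<in> hom C Z (fobj T X) \<and>
     (\<forall>Y \<in> Obj C.
        mu T (X \<otimes> Y) \<cdot> farr T (rstr C T X Y) \<cdot> str T (fobj T X) Y \<cdot> (\<iota> \<boxtimes> \<one> (fobj T Y))
          = mu T (X \<otimes> Y) \<cdot> farr T (str T X Y) \<cdot> rstr C T X (fobj T Y) \<cdot> (\<iota> \<boxtimes> \<one> (fobj T Y))))"
  for C (structure)

text \<open>Arrows of the categories below carry their domain and codomain: one arrow \<open>\<phi>\<close> of \<open>C\<close> may
  underlie several morphisms.\<close>

definition central_cones ::
  "('o, 'a, 'm) smc_scheme \<Rightarrow> ('o, 'a) smonad \<Rightarrow> 'o
     \<Rightarrow> ('o \<times> 'a, ('o \<times> 'a) \<times> 'a \<times> ('o \<times> 'a)) cat" where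
  "central_cones C T X =
     \<lparr>Obj = {c. central_cone C T X c},
      Arr = {((Z', \<iota>'), \<phi>, (Z, \<iota>)) | Z' \<iota>' \<phi> Z \<iota>.
               central_cone C T X (Z', \<iota>') \<and> central_cone C T X (Z, \<iota>) \<and>
               \<phi> \<in> hom C Z' Z \<and> \<iota> \<cdot> \<phi> = \<iota>'},
      Dom = (\<lambda>(c', \<phi>, c). c'),
      Cod = (\<lambda>(c', \<phi>, c). c),
      Ident = (\<lambda>c. (c, \<one> (fst c), c)),
      Comp = (\<lambda>(_, \<psi>, c) (c'', \<phi>, _). (c'', \<psi> \<cdot> \<phi>, c))\<rparr>"
  for C (structure)


section \<open>The Kleisli category and its premonoidal centre\<close>

definition kleisli ::
  "('o, 'a, 'm) smc_scheme \<Rightarrow> ('o, 'a) smonad \<Rightarrow> ('o, 'o \<times> 'a \<times> 'o) cat" where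
  "kleisli C T =
     \<lparr>Obj = Obj C,
      Arr = {(X, f, Y) | X f Y. X \<in> Obj C \<and> Y \<in> Obj C \<and> f \<in> hom C X (fobj T Y)},
      Dom = (\<lambda>(X, f, Y). X),
      Cod = (\<lambda>(X, f, Y). Y),
      Ident = (\<lambda>X. (X, eta T X, X)),
      Comp = (\<lambda>(_, g, Z) (X, f, _). (X, mu T Z \<cdot> farr T g \<cdot> f, Z))\<rparr>"
  for C (structure)

definition tensor_l ::
  "('o, 'a, 'm) smc_scheme \<Rightarrow> ('o, 'a) smonad \<Rightarrow> 'o \<times> 'a \<times> 'o \<Rightarrow> 'o \<Rightarrow> 'o \<times> 'a \<times> 'o" where
  "tensor_l C T = (\<lambda>(X, f, Y) W. (X \<otimes> W, rstr C T Y W \<cdot> (f \<boxtimes> \<one> W), Y \<otimes> W))"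
  for C (structure)

definition tensor_r ::
  "('o, 'a, 'm) smc_scheme \<Rightarrow> ('o, 'a) smonad \<Rightarrow> 'o \<Rightarrow> 'o \<times> 'a \<times> 'o \<Rightarrow> 'o \<times> 'a \<times> 'o" where
  "tensor_r C T = (\<lambda>W (X, f, Y). (W \<otimes> X, str T W Y \<cdot> (\<one> W \<boxtimes> f), W \<otimes> Y))"
  for C (structure)

definition central ::
  "('o, 'a, 'm) smc_scheme \<Rightarrow> ('o, 'a) smonad \<Rightarrow> 'o \<times> 'a \<times> 'o \<Rightarrow> bool" where
  "central C T f \<longleftrightarrow> f \<in> Arr (kleisli C T) \<and>
     (\<forall>f' \<in> Arr (kleisli C T).
        tensor_r C T (Cod (kleisli C T) f) f' \<cdot>\<^bsub>kleisli C T\<^esub> tensor_l C T f (Dom (kleisli C T) f')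
          = tensor_l C T f (Cod (kleisli C T) f') \<cdot>\<^bsub>kleisli C T\<^esub> tensor_r C T (Dom (kleisli C T) f) f')"

definition centre ::
  "('o, 'a, 'm) smc_scheme \<Rightarrow> ('o, 'a) smonad \<Rightarrow> ('o, 'o \<times> 'a \<times> 'o) cat" where
  "centre C T = kleisli C T \<lparr>Arr := {f. central C T f}\<rparr>"

text \<open>The next two functors also serve as their own corestrictions to \<open>centre C T\<close>: only the
  codomain category named in \<open>iso_functor\<close> or \<open>left_adjoint\<close> changes.\<close>

definition kleisli_J ::
  "('o, 'a, 'm) smc_scheme \<Rightarrow> ('o, 'a) smonad \<Rightarrow> ('o, 'a, 'o, 'o \<times> 'a \<times> 'o) func" where
  "kleisli_J C T =
     \<lparr>fobj = (\<lambda>X. X), farr = (\<lambda>f. (Dom C f, eta T (Cod C f) \<cdot> f, Cod C f))\<rparr>"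
  for C (structure)

definition kleisli_embedding ::
  "('o, 'a, 'm) smc_scheme \<Rightarrow> ('o \<Rightarrow> 'a) \<Rightarrow> ('o, 'o \<times> 'a \<times> 'o, 'o, 'o \<times> 'a \<times> 'o) func" where
  "kleisli_embedding C \<iota> =
     \<lparr>fobj = (\<lambda>X. X), farr = (\<lambda>(X, f, Y). (X, \<iota> Y \<cdot> f, Y))\<rparr>"
  for C (structure)

end

(* The hub is the universal property of a terminal central cone (Z X, \<iota> X): a Kleisli morphism
   X \<rightarrow> T Y is central iff it is a central cone at Y, i.e. it suffices to test centrality against
   the identities T Y' \<rightarrow> T Y' seen as Kleisli morphisms. Hence a terminal central cone at Y is the
   same thing as a couniversal arrow from J to Y in the centre, which gives (1) \<longleftrightarrow> (3), and under (2)
   the components of \<iota> are terminal because C_Z \<rightarrow> Z(C_T) is bijective on arrows. For (1) \<longrightarrow> (2),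
   centrals contain the image of J and are closed under composition and under W \<otimes>\<^sub>r -, so the
   structure of T restricted along \<iota> lifts to Z; uniqueness of lifts makes \<iota> X left cancellable,
   and each law of Z follows from the corresponding law of T. *)

theory Submission imports Defs begin

section \<open>Typing rules and cancellation in an arbitrary category\<close>

lemma homI: "f \<in> Arr C \<Longrightarrow> Dom C f = X \<Longrightarrow> Cod C f = Y \<Longrightarrow> f \<in> hom C X Y"
  by (simp add: hom_def)

lemma homD:
  assumes "f \<in> hom C X Y"
  shows "f \<in> Arr C" and "Dom C f = X" and "Cod C f = Y"
  using assms by (auto simp: hom_def)

text \<open>The axioms are restated with premises on \<open>Arr\<close>, \<open>Dom\<close> and \<open>Cod\<close> instead of \<open>hom\<close>: the
  simplifier cannot guess the intermediate objects that a \<open>hom\<close> premise leaves schematic.\<close>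

context category
begin

declare Dom_Obj [simp] Cod_Obj [simp]

lemma hom_Obj: "f \<in> hom C X Y \<Longrightarrow> X \<in> Obj C" "f \<in> hom C X Y \<Longrightarrow> Y \<in> Obj C"
  by (auto simp: hom_def Dom_Obj Cod_Obj)

lemma Ident_typing [simp]:
  "X \<in> Obj C \<Longrightarrow> \<one> X \<in> Arr C"
  "X \<in> Obj C \<Longrightarrow> Dom C (\<one> X) = X"
  "X \<in> Obj C \<Longrightarrow> Cod C (\<one> X) = X"
  using Ident_hom by (auto simp: hom_def)

lemma Comp_typing [simp]:
  assumes "f \<in> Arr C" "g \<in> Arr C" "Dom C g = Cod C f"
  shows "g \<cdot> f \<in> Arr C" "Dom C (g \<cdot> f) = Dom C f" "Cod C (g \<cdot> f) = Cod C g"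
  using Comp_hom[of f "Dom C f" "Cod C f" g "Cod C g"] assms by (auto simp: hom_def)

lemma Comp_Ident [simp]:
  "f \<in> Arr C \<Longrightarrow> Dom C f = X \<Longrightarrow> f \<cdot> \<one> X = f"
  "f \<in> Arr C \<Longrightarrow> Cod C f = X \<Longrightarrow> \<one> X \<cdot> f = f"
  by (auto intro!: Comp_Ident_left Comp_Ident_right simp: hom_def)

lemma assoc [simp]:
  assumes "f \<in> Arr C" "g \<in> Arr C" "h \<in> Arr C" "Dom C g = Cod C f" "Dom C h = Cod C g"
  shows "(h \<cdot> g) \<cdot> f = h \<cdot> (g \<cdot> f)"
  by (rule Comp_assoc) (use assms in \<open>auto simp: hom_def\<close>)

text \<open>The simplifier nests composites to the right, where the two-factor left side of an
  equation no longer occurs as a subterm. The tail \<open>k\<close> makes the equation usable inside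
  a chain.\<close>

lemma comp_chain:
  assumes "g \<cdot> f = h" "f \<in> Arr C" "g \<in> Arr C" "k \<in> Arr C" "Dom C g = Cod C f" "Dom C f = Cod C k"
  shows "g \<cdot> (f \<cdot> k) = h \<cdot> k"
  using assms by (simp flip: assms(1))

lemma cancel_right:
  assumes eq: "f \<cdot> e = g \<cdot> e" and "e \<cdot> p = \<one> X"
    and "f \<in> Arr C" "g \<in> Arr C" "e \<in> Arr C" "p \<in> Arr C"
    and "Dom C f = X" "Dom C g = X" "Cod C e = X" "Cod C p = Dom C e"
  shows "f = g"
  using assms(2-) arg_cong[OF eq, of "\<lambda>h. h \<cdot> p"] by simp

lemma cancel_left:
  assumes eq: "e \<cdot> f = e \<cdot> g" and "p \<cdot> e = \<one> X"
    and "f \<in> Arr C" "g \<in> Arr C" "e \<in> Arr C" "p \<in> Arr C"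
    and "Cod C f = X" "Cod C g = X" "Dom C e = X" "Dom C p = Cod C e"
  shows "f = g"
  using assms(2-) arg_cong[OF eq, of "\<lambda>h. p \<cdot> h"] by (simp flip: assoc)

lemma comp_chain3:
  assumes "g \<cdot> f \<cdot> e = h" "e \<in> Arr C" "f \<in> Arr C" "g \<in> Arr C" "k \<in> Arr C"
    "Dom C g = Cod C f" "Dom C f = Cod C e" "Dom C e = Cod C k"
  shows "g \<cdot> f \<cdot> e \<cdot> k = h \<cdot> k"
  using assms by (simp flip: assms(1))

end

section \<open>Typing and naturality rules for functors and natural transformations\<close>

context cat_functor
begin

lemma farr_typing [simp]:
  assumes "f \<in> Arr C"
  shows "farr F f \<in> Arr D" "Dom D (farr F f) = fobj F (Dom C f)" "Cod D (farr F f) = fobj F (Cod C f)"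
  using farr_hom[of f "Dom C f" "Cod C f"] assms by (auto simp: hom_def)

lemma farr_comp [simp]:
  "f \<in> Arr C \<Longrightarrow> g \<in> Arr C \<Longrightarrow> Dom C g = Cod C f \<Longrightarrow>
    farr F (g \<cdot>\<^bsub>C\<^esub> f) = farr F g \<cdot>\<^bsub>D\<^esub> farr F f"
  by (auto intro!: farr_Comp simp: hom_def)

declare fobj_Obj [simp] farr_Ident [simp]

end

context nat_trans
begin

lemma component_typing [simp]:
  assumes "X \<in> Obj C"
  shows "\<theta> X \<in> Arr D" "Dom D (\<theta> X) = fobj F X" "Cod D (\<theta> X) = fobj G X"
  using component_hom[of X] assms by (auto simp: hom_def)

lemma natural:
  assumes "f \<in> Arr C" "Cod C f = Y"
  shows "\<theta> Y \<cdot>\<^bsub>D\<^esub> farr F f = farr G f \<cdot>\<^bsub>D\<^esub> \<theta> (Dom C f)"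
  by (rule naturality) (use assms in \<open>auto simp: hom_def\<close>)

end

lemma cat_functor_id_func: "category C \<Longrightarrow> cat_functor C C id_func"
  by (simp add: cat_functor_def cat_functor_axioms_def id_func_def)

lemma cat_functor_comp_func:
  assumes "cat_functor C D F" "cat_functor D E G"
  shows "cat_functor C E (comp_func G F)"
proof -
  interpret F: cat_functor C D F by fact
  interpret G: cat_functor D E G by fact
  show ?thesis
    by unfold_locales (auto simp: comp_func_def hom_def)
qed

subsection \<open>Adjoints from couniversal arrows\<close>

text \<open>A universal arrow from \<open>F\<close> to \<open>Y\<close>, that is, a terminal object
  of the comma category of \<open>F\<close> over \<open>Y\<close>. It speaks of one \<open>Y\<close>
  at a time, so it can be compared with a terminal cone at a single object.\<close>

definition couniversal ::
  "('o, 'a, 'm) cat_scheme \<Rightarrow> ('p, 'b, 'n) cat_scheme \<Rightarrow> ('o, 'a, 'p, 'b) func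
    \<Rightarrow> 'p \<Rightarrow> 'o \<Rightarrow> 'b \<Rightarrow> bool" where
  "couniversal C D F Y R e \<longleftrightarrow> R \<in> Obj C \<and> e \<in> hom D (fobj F R) Y \<and>
     (\<forall>X \<in> Obj C. \<forall>g \<in> hom D (fobj F X) Y. \<exists>!f. f \<in> hom C X R \<and> e \<cdot>\<^bsub>D\<^esub> farr F f = g)"

text \<open>The factorisation of \<open>g\<close> is its transpose. Naturality of the counit with
  one triangle identity gives existence, naturality of the unit with the other gives
  uniqueness.\<close>

lemma (in adjunction) couniversal_counit:
  assumes Y: "Y \<in> Obj D"
  shows "couniversal C D F Y (fobj G Y) (\<epsilon> Y)"
  unfolding couniversal_def
proof (intro conjI ballI)
  note [simp] = id_func_def comp_func_def
  show "fobj G Y \<in> Obj C" using Y by simp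
  show "\<epsilon> Y \<in> hom D (fobj F (fobj G Y)) Y" using Y by (auto intro!: homI)
  fix X g assume X: "X \<in> Obj C" and "g \<in> hom D (fobj F X) Y"
  then have g [simp]: "g \<in> Arr D" "Dom D g = fobj F X" "Cod D g = Y" by (auto dest: homD)
  note Y [simp] and X [simp]
  show "\<exists>!f. f \<in> hom C X (fobj G Y) \<and> \<epsilon> Y \<cdot>\<^bsub>D\<^esub> farr F f = g"
  proof (rule ex1I[of _ "farr G g \<cdot>\<^bsub>C\<^esub> \<eta> X"], intro conjI)
    show "farr G g \<cdot>\<^bsub>C\<^esub> \<eta> X \<in> hom C X (fobj G Y)" by (auto intro!: homI)
    have "\<epsilon> Y \<cdot>\<^bsub>D\<^esub> farr F (farr G g) = g \<cdot>\<^bsub>D\<^esub> \<epsilon> (fobj F X)"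
      using counit.natural[of g Y] by simp
    from counit.source.dom.comp_chain[OF this, of "farr F (\<eta> X)"]
    show "\<epsilon> Y \<cdot>\<^bsub>D\<^esub> farr F (farr G g \<cdot>\<^bsub>C\<^esub> \<eta> X) = g"
      by (simp add: triangle_left)
  next
    fix f assume f: "f \<in> hom C X (fobj G Y) \<and> \<epsilon> Y \<cdot>\<^bsub>D\<^esub> farr F f = g"
    then have [simp]: "f \<in> Arr C" "Dom C f = X" "Cod C f = fobj G Y" by (auto dest: homD)
    have 1: "\<eta> (fobj G Y) \<cdot>\<^bsub>C\<^esub> f = farr G (farr F f) \<cdot>\<^bsub>C\<^esub> \<eta> X"
      using unit.natural[of f "fobj G Y"] by simp
    have "farr G g \<cdot>\<^bsub>C\<^esub> \<eta> X = farr G (\<epsilon> Y) \<cdot>\<^bsub>C\<^esub> farr G (farr F f) \<cdot>\<^bsub>C\<^esub> \<eta> X"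
      using f[THEN conjunct2, symmetric] by simp
    also have "\<dots> = (farr G (\<epsilon> Y) \<cdot>\<^bsub>C\<^esub> \<eta> (fobj G Y)) \<cdot>\<^bsub>C\<^esub> f"
      using 1 by simp
    also have "\<dots> = f" by (simp add: triangle_right)
    finally show "f = farr G g \<cdot>\<^bsub>C\<^esub> \<eta> X" by simp
  qed
qed

text \<open>Chosen couniversal arrows become the counit; transposes along them define the right
  adjoint on arrows and the unit. The laws follow from the defining equation of transposes or from
  their uniqueness.\<close>

lemma left_adjointI:
  fixes F :: "('o, 'a, 'p, 'b) func"
  assumes "cat_functor C D F"
    and ex: "\<And>Y. Y \<in> Obj D \<Longrightarrow> \<exists>R e. couniversal C D F Y R e"
  shows "left_adjoint C D F"
proof -
  interpret F: cat_functor C D F by fact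
  obtain R e where Re: "\<And>Y. Y \<in> Obj D \<Longrightarrow> couniversal C D F Y (R Y) (e Y)"
    using ex by metis
  have R [simp]: "R Y \<in> Obj C"
    and e [simp]: "e Y \<in> Arr D" "Dom D (e Y) = fobj F (R Y)" "Cod D (e Y) = Y"
    if "Y \<in> Obj D" for Y
    using Re[OF that] by (auto simp: couniversal_def hom_def)
  \<comment> \<open>The transpose of \<open>g\<close>, meaningful only for \<open>g\<close> from
    \<open>fobj F X\<close> to \<open>Y\<close>, as the next fact requires.\<close>
  define lift where "lift X Y g = (THE f. f \<in> hom C X (R Y) \<and> e Y \<cdot>\<^bsub>D\<^esub> farr F f = g)" for X Y g
  have lift: "lift X Y g \<in> hom C X (R Y) \<and> e Y \<cdot>\<^bsub>D\<^esub> farr F (lift X Y g) = g"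
    if "X \<in> Obj C" "Y \<in> Obj D" "g \<in> Arr D" "Dom D g = fobj F X" "Cod D g = Y" for X Y g
    unfolding lift_def
    by (rule theI') (use Re[OF that(2)] that in \<open>auto simp: couniversal_def hom_def\<close>)
  have lift_typing [simp]: "lift X Y g \<in> Arr C" "Dom C (lift X Y g) = X" "Cod C (lift X Y g) = R Y"
    and e_lift [simp]: "e Y \<cdot>\<^bsub>D\<^esub> farr F (lift X Y g) = g"
    if "X \<in> Obj C" "Y \<in> Obj D" "g \<in> Arr D" "Dom D g = fobj F X" "Cod D g = Y" for X Y g
    using lift[OF that] by (auto dest: homD)
  have e_lift_chain [simp]: "e Y \<cdot>\<^bsub>D\<^esub> farr F (lift X Y g) \<cdot>\<^bsub>D\<^esub> k = g \<cdot>\<^bsub>D\<^esub> k"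
    if "X \<in> Obj C" "Y \<in> Obj D" "g \<in> Arr D" "Dom D g = fobj F X" "Cod D g = Y"
      "k \<in> Arr D" "Cod D k = fobj F X" for X Y g k
    by (rule F.cod.comp_chain[OF e_lift]) (use that in auto)
  have eq: "f = f'"
    if "e Y \<cdot>\<^bsub>D\<^esub> farr F f = e Y \<cdot>\<^bsub>D\<^esub> farr F f'"
      "Y \<in> Obj D" "f \<in> hom C X (R Y)" "f' \<in> hom C X (R Y)" for X Y f f'
  proof -
    have "X \<in> Obj C" "e Y \<cdot>\<^bsub>D\<^esub> farr F f \<in> hom D (fobj F X) Y"
      using that by (auto simp: hom_def)
    with Re[OF that(2)] that show ?thesis unfolding couniversal_def by metis
  qed
  \<comment> \<open>On arrows, \<open>G\<close> takes the only value that makes \<open>e\<close>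
    natural.\<close>
  define G :: "('p, 'b, 'o, 'a) func"
    where "G = \<lparr>fobj = R, farr = (\<lambda>g. lift (R (Dom D g)) (Cod D g) (g \<cdot>\<^bsub>D\<^esub> e (Dom D g)))\<rparr>"
  have G [simp]: "fobj G = R"
    "farr G = (\<lambda>g. lift (R (Dom D g)) (Cod D g) (g \<cdot>\<^bsub>D\<^esub> e (Dom D g)))"
    by (simp_all add: G_def)
  interpret G: cat_functor D C G
  proof
    fix X Y Z f g assume "f \<in> hom D X Y" "g \<in> hom D Y Z"
    then have [simp]: "f \<in> Arr D" "Dom D f = X" "Cod D f = Y" "X \<in> Obj D" "Y \<in> Obj D"
      "g \<in> Arr D" "Dom D g = Y" "Cod D g = Z" "Z \<in> Obj D" by (auto dest: homD F.cod.hom_Obj)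
    show "farr G (g \<cdot>\<^bsub>D\<^esub> f) = farr G g \<cdot>\<^bsub>C\<^esub> farr G f"
      by (rule eq[of Z _ _ "R X"]) (auto intro!: homI)
  next
    fix X assume "X \<in> Obj D"
    then show "farr G (\<one>\<^bsub>D\<^esub> X) = \<one>\<^bsub>C\<^esub> (fobj G X)"
      by (intro eq[of X _ _ "R X"]) (auto intro!: homI)
  qed (auto simp: hom_def)
  \<comment> \<open>The transpose of the identity: the left triangle identity read as a
    definition.\<close>
  define u where "u X = lift X (fobj F X) (\<one>\<^bsub>D\<^esub> (fobj F X))" for X
  note [simp] = id_func_def comp_func_def
  interpret u: nat_trans C C id_func "comp_func G F" u
  proof (intro nat_trans.intro nat_trans_axioms.intro)
    show "cat_functor C C id_func" by (rule cat_functor_id_func[OF F.dom.category_axioms])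
    show "cat_functor C C (comp_func G F)"
      by (rule cat_functor_comp_func[OF F.cat_functor_axioms G.cat_functor_axioms])
  next
    fix X assume "X \<in> Obj C"
    then show "u X \<in> hom C (fobj id_func X) (fobj (comp_func G F) X)"
      by (auto simp: u_def intro!: homI)
  next
    fix X Y f assume "f \<in> hom C X Y"
    then have [simp]: "f \<in> Arr C" "Dom C f = X" "Cod C f = Y" "X \<in> Obj C" "Y \<in> Obj C"
      by (auto dest: homD F.dom.hom_Obj)
    show "u Y \<cdot>\<^bsub>C\<^esub> farr id_func f = farr (comp_func G F) f \<cdot>\<^bsub>C\<^esub> u X"
      by (rule eq[of "fobj F Y" _ _ X]) (auto intro!: homI simp: u_def)
  qed
  interpret e: nat_trans D D "comp_func F G" id_func e
  proof (intro nat_trans.intro nat_trans_axioms.intro)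
    show "cat_functor D D id_func" by (rule cat_functor_id_func[OF F.cod.category_axioms])
    show "cat_functor D D (comp_func F G)"
      by (rule cat_functor_comp_func[OF G.cat_functor_axioms F.cat_functor_axioms])
  qed (auto simp: hom_def)
  have "adjunction C D F G u e"
  proof
    fix X assume [simp]: "X \<in> Obj C"
    show "e (fobj F X) \<cdot>\<^bsub>D\<^esub> farr F (u X) = \<one>\<^bsub>D\<^esub> (fobj F X)" by (simp add: u_def)
  next
    fix Y assume [simp]: "Y \<in> Obj D"
    show "farr G (e Y) \<cdot>\<^bsub>C\<^esub> u (fobj G Y) = \<one>\<^bsub>C\<^esub> (fobj G Y)"
      by (rule eq[of Y _ _ "R Y"]) (auto intro!: homI simp: u_def)
  qed
  then show ?thesis unfolding left_adjoint_def by blast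
qed

lemma left_adjoint_iff_couniversal:
  assumes "cat_functor C D F"
  shows "left_adjoint C D F \<longleftrightarrow> (\<forall>Y \<in> Obj D. \<exists>R e. couniversal C D F Y R e)"
  using left_adjointI[OF assms] adjunction.couniversal_counit[of C D F]
  unfolding left_adjoint_def by meson

section \<open>Tensor calculus in a symmetric monoidal category\<close>

context symmetric_monoidal_category
begin

declare Tobj_Obj [simp] Unit_Obj [simp] Tarr_Ident [simp]

lemma Tarr_typing [simp]:
  assumes "f \<in> Arr C" "g \<in> Arr C"
  shows "f \<boxtimes> g \<in> Arr C" "Dom C (f \<boxtimes> g) = Dom C f \<otimes> Dom C g" "Cod C (f \<boxtimes> g) = Cod C f \<otimes> Cod C g"
  using Tarr_hom[of f "Dom C f" "Cod C f" g "Dom C g" "Cod C g"] assms by (auto simp: hom_def)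

lemma structure_typing [simp]:
  "X \<in> Obj C \<Longrightarrow> Y \<in> Obj C \<Longrightarrow> \<gamma> X Y \<in> Arr C"
  "X \<in> Obj C \<Longrightarrow> Y \<in> Obj C \<Longrightarrow> Dom C (\<gamma> X Y) = X \<otimes> Y"
  "X \<in> Obj C \<Longrightarrow> Y \<in> Obj C \<Longrightarrow> Cod C (\<gamma> X Y) = Y \<otimes> X"
  "X \<in> Obj C \<Longrightarrow> Y \<in> Obj C \<Longrightarrow> Z \<in> Obj C \<Longrightarrow> \<alpha> X Y Z \<in> Arr C"
  "X \<in> Obj C \<Longrightarrow> Y \<in> Obj C \<Longrightarrow> Z \<in> Obj C \<Longrightarrow> Dom C (\<alpha> X Y Z) = (X \<otimes> Y) \<otimes> Z"
  "X \<in> Obj C \<Longrightarrow> Y \<in> Obj C \<Longrightarrow> Z \<in> Obj C \<Longrightarrow> Cod C (\<alpha> X Y Z) = X \<otimes> (Y \<otimes> Z)"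
  "X \<in> Obj C \<Longrightarrow> \<l> X \<in> Arr C"
  "X \<in> Obj C \<Longrightarrow> Dom C (\<l> X) = \<I> \<otimes> X"
  "X \<in> Obj C \<Longrightarrow> Cod C (\<l> X) = X"
  using Sym_hom Assoc_iso Lunit_iso by (auto simp: iso_arr_def hom_def)

lemma Tarr_comp:
  assumes "f \<in> Arr C" "f' \<in> Arr C" "g \<in> Arr C" "g' \<in> Arr C" "Dom C f' = Cod C f" "Dom C g' = Cod C g"
  shows "(f' \<boxtimes> g') \<cdot> (f \<boxtimes> g) = (f' \<cdot> f) \<boxtimes> (g' \<cdot> g)"
  by (rule Tarr_Comp[symmetric]) (use assms in \<open>auto simp: hom_def\<close>)

text \<open>\<open>Tarr_comp\<close> merges tensored arrows; this opposite direction separates a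
  whiskered composite into whiskered factors.\<close>

lemma Tarr_Ident_comp:
  "f \<in> Arr C \<Longrightarrow> g \<in> Arr C \<Longrightarrow> Dom C g = Cod C f \<Longrightarrow> X \<in> Obj C \<Longrightarrow>
    \<one> X \<boxtimes> (g \<cdot> f) = (\<one> X \<boxtimes> g) \<cdot> (\<one> X \<boxtimes> f)"
  "f \<in> Arr C \<Longrightarrow> g \<in> Arr C \<Longrightarrow> Dom C g = Cod C f \<Longrightarrow> X \<in> Obj C \<Longrightarrow>
    (g \<cdot> f) \<boxtimes> \<one> X = (g \<boxtimes> \<one> X) \<cdot> (f \<boxtimes> \<one> X)"
  by (simp_all add: Tarr_comp)

lemma Sym_natural:
  assumes "f \<in> Arr C" "g \<in> Arr C" "Cod C f = X" "Cod C g = Y"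
  shows "\<gamma> X Y \<cdot> (f \<boxtimes> g) = (g \<boxtimes> f) \<cdot> \<gamma> (Dom C f) (Dom C g)"
  by (rule Sym_nat) (use assms in \<open>auto simp: hom_def\<close>)

lemma Assoc_natural:
  assumes "f \<in> Arr C" "g \<in> Arr C" "h \<in> Arr C" "Cod C f = X" "Cod C g = Y" "Cod C h = Z"
  shows "\<alpha> X Y Z \<cdot> ((f \<boxtimes> g) \<boxtimes> h) = (f \<boxtimes> (g \<boxtimes> h)) \<cdot> \<alpha> (Dom C f) (Dom C g) (Dom C h)"
  by (rule Assoc_nat) (use assms in \<open>auto simp: hom_def\<close>)

end

subsection \<open>The Kleisli category and its premonoidal structure\<close>

context strong_monad
begin

abbreviation "K \<equiv> kleisli C T"
abbreviation "J \<equiv> farr (kleisli_J C T)"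
abbreviation "R \<equiv> tensor_r C T"
abbreviation "L \<equiv> tensor_l C T"

lemma id_comp_func [simp]:
  "fobj id_func X = X" "farr id_func f = f"
  "fobj (comp_func F G) X = fobj F (fobj G X)" "farr (comp_func F G) f = farr F (farr G f)"
  by (simp_all add: id_func_def comp_func_def)

lemma T_typing [simp]:
  "X \<in> Obj C \<Longrightarrow> fobj T X \<in> Obj C"
  "f \<in> Arr C \<Longrightarrow> farr T f \<in> Arr C"
  "f \<in> Arr C \<Longrightarrow> Dom C (farr T f) = fobj T (Dom C f)"
  "f \<in> Arr C \<Longrightarrow> Cod C (farr T f) = fobj T (Cod C f)"
  "X \<in> Obj C \<Longrightarrow> eta T X \<in> Arr C"
  "X \<in> Obj C \<Longrightarrow> Dom C (eta T X) = X"
  "X \<in> Obj C \<Longrightarrow> Cod C (eta T X) = fobj T X"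
  "X \<in> Obj C \<Longrightarrow> mu T X \<in> Arr C"
  "X \<in> Obj C \<Longrightarrow> Dom C (mu T X) = fobj T (fobj T X)"
  "X \<in> Obj C \<Longrightarrow> Cod C (mu T X) = fobj T X"
  "X \<in> Obj C \<Longrightarrow> Y \<in> Obj C \<Longrightarrow> str T X Y \<in> Arr C"
  "X \<in> Obj C \<Longrightarrow> Y \<in> Obj C \<Longrightarrow> Dom C (str T X Y) = X \<otimes> fobj T Y"
  "X \<in> Obj C \<Longrightarrow> Y \<in> Obj C \<Longrightarrow> Cod C (str T X Y) = fobj T (X \<otimes> Y)"
  using str_hom[of X Y]
  by (simp_all add: hom_def)

lemma eta_natural:
  "f \<in> Arr C \<Longrightarrow> Cod C f = Y \<Longrightarrow> eta T Y \<cdot> f = farr T f \<cdot> eta T (Dom C f)"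
  using unit.natural[of f Y] by simp

text \<open>Naturality of the unit moves \<open>eta\<close> to the left of \<open>f\<close>, where
  it cancels against \<open>mu\<close>. This is the right identity law of Kleisli
  composition.\<close>

lemma mu_T_eta:
  assumes "f \<in> Arr C" "Cod C f = fobj T Y" "Y \<in> Obj C"
  shows "mu T Y \<cdot> farr T f \<cdot> eta T (Dom C f) = f"
proof -
  have "mu T Y \<cdot> eta T (fobj T Y) \<cdot> f = f"
    using assms by (subst comp_chain[OF mu_eta_left]) auto
  then show ?thesis using assms by (simp add: eta_natural)
qed

lemma mu_natural:
  "f \<in> Arr C \<Longrightarrow> Cod C f = Y \<Longrightarrow> mu T Y \<cdot> farr T (farr T f) = farr T f \<cdot> mu T (Dom C f)"
  using mult.natural[of f Y] by simp

lemma str_natural: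
  assumes "f \<in> Arr C" "g \<in> Arr C" "Cod C f = X" "Cod C g = Y"
  shows "str T X Y \<cdot> (f \<boxtimes> farr T g) = farr T (f \<boxtimes> g) \<cdot> str T (Dom C f) (Dom C g)"
  by (rule str_nat) (use assms in \<open>auto simp: hom_def\<close>)

text \<open>The case \<open>g = \<one> Y\<close> of \<open>str_natural\<close>, where
  \<open>farr T g\<close> has been simplified to an identity and would not match the general
  rule.\<close>

lemma str_natural_left:
  assumes "f \<in> Arr C" "Cod C f = X" "Y \<in> Obj C"
  shows "str T X Y \<cdot> (f \<boxtimes> \<one> (fobj T Y)) = farr T (f \<boxtimes> \<one> Y) \<cdot> str T (Dom C f) Y"
  using str_natural[of f "\<one> Y" X Y] assms by simp

lemma rstr_typing [simp]:
  assumes "X \<in> Obj C" "Y \<in> Obj C"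
  shows "rstr C T X Y \<in> Arr C" "Dom C (rstr C T X Y) = fobj T X \<otimes> Y"
    "Cod C (rstr C T X Y) = fobj T (X \<otimes> Y)"
  using assms by (simp_all add: rstr_def)

lemma K_simps [simp]:
  "Obj K = Obj C"
  "(X, f, Y) \<in> Arr K \<longleftrightarrow> X \<in> Obj C \<and> Y \<in> Obj C \<and> f \<in> Arr C \<and> Dom C f = X \<and> Cod C f = fobj T Y"
  "Dom K (X, f, Y) = X" "Cod K (X, f, Y) = Y"
  by (auto simp: kleisli_def hom_def)

lemma K_Ident: "\<one>\<^bsub>K\<^esub> X = (X, eta T X, X)"
  by (simp add: kleisli_def)

lemma K_Comp [simp]:
  "(Y', g, Z) \<cdot>\<^bsub>K\<^esub> (X, f, Y) = (X, mu T Z \<cdot> farr T g \<cdot> f, Z)"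
  by (simp add: kleisli_def)

lemma J_eq: "f \<in> Arr C \<Longrightarrow> J f = (Dom C f, eta T (Cod C f) \<cdot> f, Cod C f)"
  by (simp add: kleisli_J_def)

lemma category_K: "category K"
proof
  fix f assume "f \<in> Arr K" then show "Dom K f \<in> Obj K" "Cod K f \<in> Obj K"
    by (cases f; simp)+
next
  fix f X Y assume "f \<in> hom K X Y"
  then obtain f' where [simp]: "f = (X, f', Y)" "f' \<in> Arr C" "Dom C f' = X" "Cod C f' = fobj T Y"
     "X \<in> Obj C" "Y \<in> Obj C"
    by (cases f) (auto simp: hom_def)
  show "f \<cdot>\<^bsub>K\<^esub> \<one>\<^bsub>K\<^esub> X = f"
    using mu_T_eta[of f' Y] by (simp add: K_Ident)
  show "\<one>\<^bsub>K\<^esub> Y \<cdot>\<^bsub>K\<^esub> f = f"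
    by (simp add: K_Ident comp_chain[OF mu_eta_right])
  fix g Z assume "g \<in> hom K Y Z"
  then obtain g' where [simp]: "g = (Y, g', Z)" "g' \<in> Arr C" "Dom C g' = Y" "Cod C g' = fobj T Z"
     "Z \<in> Obj C"
    by (cases g) (auto simp: hom_def)
  show "g \<cdot>\<^bsub>K\<^esub> f \<in> hom K X Z" by (simp add: hom_def)
  fix h W assume "h \<in> hom K Z W"
  then obtain h' where [simp]: "h = (Z, h', W)" "h' \<in> Arr C" "Dom C h' = Z" "Cod C h' = fobj T W"
     "W \<in> Obj C"
    by (cases h) (auto simp: hom_def)
  show "(h \<cdot>\<^bsub>K\<^esub> g) \<cdot>\<^bsub>K\<^esub> f = h \<cdot>\<^bsub>K\<^esub> g \<cdot>\<^bsub>K\<^esub> f"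
    by (simp add: mu_natural comp_chain[OF mu_natural] comp_chain[OF mu_mu[symmetric]])
qed (auto simp: hom_def K_Ident)

lemma J_cat_functor: "cat_functor C K (kleisli_J C T)"
proof -
  interpret K: category K by (rule category_K)
  show ?thesis
  proof
    fix f g X Y Z assume "f \<in> hom C X Y" "g \<in> hom C Y Z"
    then have [simp]: "f \<in> Arr C" "Dom C f = X" "Cod C f = Y" "X \<in> Obj C" "Y \<in> Obj C"
      "g \<in> Arr C" "Dom C g = Y" "Cod C g = Z" "Z \<in> Obj C" by (auto dest: homD hom_Obj)
    show "J (g \<cdot> f) = J g \<cdot>\<^bsub>K\<^esub> J f"
      using comp_chain[OF eta_natural, of g Z f]
      by (simp add: J_eq comp_chain[OF eta_natural] comp_chain[OF mu_eta_right])
  qed (auto simp: kleisli_J_def hom_def K_Ident)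
qed

interpretation K: category K by (rule category_K)
interpretation J: cat_functor C K "kleisli_J C T" by (rule J_cat_functor)

lemma fobj_J [simp]: "fobj (kleisli_J C T) X = X"
  by (simp add: kleisli_J_def)

lemma J_typing [simp]:
  assumes "f \<in> Arr C"
  shows "J f \<in> Arr K" "Dom K (J f) = Dom C f" "Cod K (J f) = Cod C f"
  using J.farr_typing[OF assms] by simp_all

lemma K_cases:
  assumes "f \<in> Arr K"
  obtains X f' Y where "f = (X, f', Y)" "X \<in> Obj C" "Y \<in> Obj C" "f' \<in> Arr C" "Dom C f' = X" "Cod C f' = fobj T Y"
    "Dom K f = X" "Cod K f = Y"
  using assms by (cases f) auto

text \<open>The unit contained in \<open>J g\<close> is absorbed by \<open>mu_T_eta\<close>. With
  \<open>J_comp\<close> this translates Kleisli equations into equations of \<open>C\<close>;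
  \<open>fst (snd f)\<close> is the underlying arrow.\<close>

lemma comp_J:
  assumes "f \<in> Arr K" "g \<in> Arr C" "Dom K f = Cod C g"
  shows "f \<cdot>\<^bsub>K\<^esub> J g = (Dom C g, fst (snd f) \<cdot> g, Cod K f)"
proof -
  obtain X f' Y where f [simp]: "f = (X, f', Y)" "X \<in> Obj C" "Y \<in> Obj C" "f' \<in> Arr C" "Dom C f' = X" "Cod C f' = fobj T Y"
    by (rule K_cases[OF assms(1)])
  have "mu T Y \<cdot> farr T f' \<cdot> eta T X \<cdot> g = f' \<cdot> g"
    using assms comp_chain3[OF mu_T_eta[of f' Y], of g] by simp
  then show ?thesis using assms by (simp add: J_eq)
qed

lemma J_comp:
  assumes "f \<in> Arr K" "g \<in> Arr C" "Dom C g = Cod K f"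
  shows "J g \<cdot>\<^bsub>K\<^esub> f = (Dom K f, farr T g \<cdot> fst (snd f), Cod C g)"
proof -
  obtain X f' Y where f [simp]: "f = (X, f', Y)" "X \<in> Obj C" "Y \<in> Obj C" "f' \<in> Arr C" "Dom C f' = X" "Cod C f' = fobj T Y"
    by (rule K_cases[OF assms(1)])
  show ?thesis using assms by (simp add: J_eq comp_chain[OF mu_eta_right])
qed

section \<open>The two whiskering operations on Kleisli morphisms\<close>

lemma R_L_eq [simp]:
  "R W (X, f, Y) = (W \<otimes> X, str T W Y \<cdot> (\<one> W \<boxtimes> f), W \<otimes> Y)"
  "L (X, f, Y) W = (X \<otimes> W, rstr C T Y W \<cdot> (f \<boxtimes> \<one> W), Y \<otimes> W)"
  by (simp_all add: tensor_r_def tensor_l_def)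

lemma R_typing [simp]:
  assumes "f \<in> Arr K" "W \<in> Obj C"
  shows "R W f \<in> Arr K" "Dom K (R W f) = W \<otimes> Dom K f" "Cod K (R W f) = W \<otimes> Cod K f"
  using assms by (auto elim!: K_cases)

text \<open>Functoriality of whiskering is \<open>str_mu\<close> together with naturality of the
  strength in its second argument.\<close>

lemma R_comp:
  assumes "f \<in> Arr K" "g \<in> Arr K" "Dom K g = Cod K f" "W \<in> Obj C"
  shows "R W (g \<cdot>\<^bsub>K\<^esub> f) = R W g \<cdot>\<^bsub>K\<^esub> R W f"
proof -
  obtain X f' Y where [simp]: "f = (X, f', Y)" "X \<in> Obj C" "Y \<in> Obj C" "f' \<in> Arr C" "Dom C f' = X" "Cod C f' = fobj T Y"
    by (rule K_cases[OF assms(1)])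
  obtain g' Z where [simp]: "g = (Y, g', Z)" "Z \<in> Obj C" "g' \<in> Arr C" "Dom C g' = Y" "Cod C g' = fobj T Z"
    by (rule K_cases[OF assms(2)]) (use assms in simp)
  note [simp] = assms(4)
  show ?thesis
    using comp_chain[OF str_mu[of W Z], of "\<one> W \<boxtimes> (farr T g' \<cdot> f')"]
      comp_chain[OF str_natural[of "\<one> W" g' W "fobj T Z"], of "\<one> W \<boxtimes> f'"]
    by (simp add: Tarr_Ident_comp)
qed

lemma R_J:
  assumes "f \<in> Arr C" "W \<in> Obj C"
  shows "R W (J f) = J (\<one> W \<boxtimes> f)"
  using assms by (simp add: J_eq Tarr_Ident_comp comp_chain[OF str_eta])

lemma R_assoc:
  assumes "f \<in> Arr K" "W \<in> Obj C" "V \<in> Obj C"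
  shows "J (\<alpha> W V (Cod K f)) \<cdot>\<^bsub>K\<^esub> R (W \<otimes> V) f = R W (R V f) \<cdot>\<^bsub>K\<^esub> J (\<alpha> W V (Dom K f))"
proof -
  obtain X f' Y where [simp]: "f = (X, f', Y)" "X \<in> Obj C" "Y \<in> Obj C" "f' \<in> Arr C" "Dom C f' = X" "Cod C f' = fobj T Y"
    by (rule K_cases[OF assms(1)])
  note [simp] = assms(2,3)
  have 1: "\<alpha> W V (fobj T Y) \<cdot> ((\<one> W \<boxtimes> \<one> V) \<boxtimes> f') = (\<one> W \<boxtimes> (\<one> V \<boxtimes> f')) \<cdot> \<alpha> W V X"
    by (subst Assoc_natural) auto
  show ?thesis using 1
    by (simp add: J_comp comp_J comp_chain[OF str_Assoc] Tarr_Ident_comp)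
qed

text \<open>\<open>rstr\<close> is \<open>str\<close> conjugated by the symmetry, and naturality of
  the symmetry extends this to whiskering. Facts about \<open>L\<close> are therefore derived from
  those about \<open>R\<close>.\<close>

lemma L_eq_R:
  assumes "f \<in> Arr K" "W \<in> Obj C"
  shows "L f W = J (\<gamma> W (Cod K f)) \<cdot>\<^bsub>K\<^esub> R W f \<cdot>\<^bsub>K\<^esub> J (\<gamma> (Dom K f) W)"
proof -
  obtain X f' Y where [simp]: "f = (X, f', Y)" "X \<in> Obj C" "Y \<in> Obj C" "f' \<in> Arr C" "Dom C f' = X" "Cod C f' = fobj T Y"
    by (rule K_cases[OF assms(1)])
  note [simp] = assms(2)
  show ?thesis
    using Sym_natural[of f' "\<one> W" "fobj T Y" W]
    by (simp add: J_comp comp_J rstr_def)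
qed

text \<open>Naturality of the strength in its first argument. Since whiskering \<open>J w\<close>
  gives \<open>J\<close> of a tensor, this is also the interchange law behind
  \<open>central_J\<close>.\<close>

lemma R_natural:
  assumes "f \<in> Arr K" "w \<in> Arr C" "Cod C w = W"
  shows "R W f \<cdot>\<^bsub>K\<^esub> J (w \<boxtimes> \<one> (Dom K f)) = J (w \<boxtimes> \<one> (Cod K f)) \<cdot>\<^bsub>K\<^esub> R (Dom C w) f"
proof -
  obtain X f' Y where [simp]: "f = (X, f', Y)" "X \<in> Obj C" "Y \<in> Obj C" "f' \<in> Arr C" "Dom C f' = X" "Cod C f' = fobj T Y"
    by (rule K_cases[OF assms(1)])
  note [simp] = assms(2,3)
  have "W \<in> Obj C" using assms Cod_Obj by blast
  then show ?thesis
    using comp_chain[OF str_natural_left[of w W Y], of "\<one> (Dom C w) \<boxtimes> f'"]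
    by (simp add: J_comp comp_J Tarr_comp)
qed

lemma J_chain:
  assumes "g \<cdot> f = h" "f \<in> Arr C" "g \<in> Arr C" "Dom C g = Cod C f" "k \<in> Arr K" "Dom C f = Cod K k"
  shows "J g \<cdot>\<^bsub>K\<^esub> J f \<cdot>\<^bsub>K\<^esub> k = J h \<cdot>\<^bsub>K\<^esub> k"
  by (rule K.comp_chain) (use assms in auto)

lemma J_Ident [simp]: "X \<in> Obj C \<Longrightarrow> J (\<one> X) = \<one>\<^bsub>K\<^esub> X"
  using J.farr_Ident[of X] by simp

lemma L_typing [simp]:
  assumes "f \<in> Arr K" "W \<in> Obj C"
  shows "L f W \<in> Arr K" "Dom K (L f W) = Dom K f \<otimes> W" "Cod K (L f W) = Cod K f \<otimes> W"
  using assms by (auto elim!: K_cases)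

lemma Dom_K_Obj [simp]: "f \<in> Arr K \<Longrightarrow> Dom K f \<in> Obj C" "f \<in> Arr K \<Longrightarrow> Cod K f \<in> Obj C"
  using K.Dom_Obj K.Cod_Obj by auto

lemma L_comp:
  assumes "f \<in> Arr K" "g \<in> Arr K" "Dom K g = Cod K f" "W \<in> Obj C"
  shows "L (g \<cdot>\<^bsub>K\<^esub> f) W = L g W \<cdot>\<^bsub>K\<^esub> L f W"
  using assms by (simp add: L_eq_R R_comp J_chain[OF Sym_Sym])

lemma L_J:
  assumes "f \<in> Arr C" "W \<in> Obj C"
  shows "L (J f) W = J (f \<boxtimes> \<one> W)"
proof -
  have "\<gamma> W (Cod C f) \<cdot> (\<one> W \<boxtimes> f) \<cdot> \<gamma> (Dom C f) W = f \<boxtimes> \<one> W"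
    using assms by (simp add: comp_chain[OF Sym_natural] Sym_Sym)
  then have "J (\<gamma> W (Cod C f) \<cdot> (\<one> W \<boxtimes> f) \<cdot> \<gamma> (Dom C f) W) = J (f \<boxtimes> \<one> W)"
    by simp
  then show ?thesis
    using assms by (simp add: L_eq_R R_J)
qed

text \<open>The symmetry exchanges the tensor factors on which \<open>w\<close> and \<open>f\<close>
  act, and so carries \<open>R_natural\<close> to this equation.\<close>

lemma L_natural:
  assumes f: "f \<in> Arr K" and w: "w \<in> Arr C" "Cod C w = W"
  shows "J (\<one> (Cod K f) \<boxtimes> w) \<cdot>\<^bsub>K\<^esub> L f (Dom C w) = L f W \<cdot>\<^bsub>K\<^esub> J (\<one> (Dom K f) \<boxtimes> w)"
proof -
  note [simp] = f w
  have [simp]: "W \<in> Obj C" using w Cod_Obj by blast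
  have 1: "J (\<one> (Cod K f) \<boxtimes> w) \<cdot>\<^bsub>K\<^esub> J (\<gamma> (Dom C w) (Cod K f))
      = J (\<gamma> W (Cod K f)) \<cdot>\<^bsub>K\<^esub> J (w \<boxtimes> \<one> (Cod K f))"
    using arg_cong[OF Sym_natural[of w "\<one> (Cod K f)" W "Cod K f"], of J] by simp
  have 2: "J (\<gamma> (Dom K f) W) \<cdot>\<^bsub>K\<^esub> J (\<one> (Dom K f) \<boxtimes> w)
      = J (w \<boxtimes> \<one> (Dom K f)) \<cdot>\<^bsub>K\<^esub> J (\<gamma> (Dom K f) (Dom C w))"
    using arg_cong[OF Sym_natural[of "\<one> (Dom K f)" w "Dom K f" W], of J] by simp
  show ?thesis
    by (simp add: L_eq_R K.comp_chain[OF 1] 2 K.comp_chain[OF R_natural])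
qed

text \<open>Once \<open>L\<close> is expressed through \<open>R\<close> and the symmetry, the
  hexagon relates the two orders of whiskering and \<open>R_assoc\<close> moves \<open>f\<close>
  past the associators. This is the compatibility that \<open>central_R\<close> relies on.\<close>

lemma L_R_assoc:
  assumes f: "f \<in> Arr K" and WV: "W \<in> Obj C" "V \<in> Obj C"
  shows "J (\<alpha> W (Cod K f) V) \<cdot>\<^bsub>K\<^esub> L (R W f) V = R W (L f V) \<cdot>\<^bsub>K\<^esub> J (\<alpha> W (Dom K f) V)"
    (is "?l = ?r")
proof -
  note [simp] = f WV
  define X Y where "X = Dom K f" and "Y = Cod K f"
  have [simp]: "X \<in> Obj C" "Y \<in> Obj C" "Dom K f = X" "Cod K f = Y"
    using f by (auto simp: X_def Y_def)
  obtain b where b [simp]: "b \<in> Arr C" "Dom C b = V \<otimes> (W \<otimes> X)" "Cod C b = (V \<otimes> W) \<otimes> X"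
    and ab: "\<alpha> V W X \<cdot> b = \<one> (V \<otimes> (W \<otimes> X))"
    using Assoc_iso[of V W X] by (auto simp: iso_arr_def hom_def)
  \<comment> \<open>Precomposing with the isomorphism \<open>?e\<close> creates the two instances of the hexagon, at \<open>X\<close> and \<open>Y\<close>.\<close>
  let ?e = "\<gamma> V (W \<otimes> X) \<cdot> \<alpha> V W X" and ?p = "b \<cdot> \<gamma> (W \<otimes> X) V"
  have inv: "J ?e \<cdot>\<^bsub>K\<^esub> J ?p = \<one>\<^bsub>K\<^esub> ((W \<otimes> X) \<otimes> V)"
  proof -
    have "?e \<cdot> ?p = \<one> ((W \<otimes> X) \<otimes> V)"
      by (simp add: comp_chain[OF ab] Sym_Sym)
    from arg_cong[OF this, of J] show ?thesis by simp
  qed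
  have hex: "J (\<alpha> W Z V) \<cdot>\<^bsub>K\<^esub> J (\<gamma> V (W \<otimes> Z)) \<cdot>\<^bsub>K\<^esub> J (\<alpha> V W Z)
     = J (\<one> W \<boxtimes> \<gamma> V Z) \<cdot>\<^bsub>K\<^esub> J (\<alpha> W V Z) \<cdot>\<^bsub>K\<^esub> J (\<gamma> V W \<boxtimes> \<one> Z)"
    if "Z \<in> Obj C" for Z
    using arg_cong[OF hexagon[of V W Z], of J] that by simp
  have nat: "R (W \<otimes> V) f \<cdot>\<^bsub>K\<^esub> J (\<gamma> V W \<boxtimes> \<one> X) = J (\<gamma> V W \<boxtimes> \<one> Y) \<cdot>\<^bsub>K\<^esub> R (V \<otimes> W) f"
    using R_natural[of f "\<gamma> V W" "W \<otimes> V"] by simp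
  have as: "R W (R V f) \<cdot>\<^bsub>K\<^esub> J (\<alpha> W V X) = J (\<alpha> W V Y) \<cdot>\<^bsub>K\<^esub> R (W \<otimes> V) f"
           "R V (R W f) \<cdot>\<^bsub>K\<^esub> J (\<alpha> V W X) = J (\<alpha> V W Y) \<cdot>\<^bsub>K\<^esub> R (V \<otimes> W) f"
    using R_assoc[of f W V] R_assoc[of f V W] by simp_all
  \<comment> \<open>Inside \<open>R W (L f V)\<close> the expansion of \<open>L\<close> leaves a
    symmetry inverse to the one supplied by the hexagon.\<close>
  have "\<And>k. k \<in> Arr K \<Longrightarrow> Cod K k = W \<otimes> (V \<otimes> X) \<Longrightarrow>
     J (\<one> W \<boxtimes> \<gamma> X V) \<cdot>\<^bsub>K\<^esub> J (\<one> W \<boxtimes> \<gamma> V X) \<cdot>\<^bsub>K\<^esub> k = k"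
    by (subst J_chain[where h = "\<one> (W \<otimes> (V \<otimes> X))"]) (auto simp: Tarr_comp Sym_Sym)
  then have r: "?r \<cdot>\<^bsub>K\<^esub> J ?e = J (\<one> W \<boxtimes> \<gamma> V Y) \<cdot>\<^bsub>K\<^esub> J (\<alpha> W V Y) \<cdot>\<^bsub>K\<^esub> J (\<gamma> V W \<boxtimes> \<one> Y) \<cdot>\<^bsub>K\<^esub> R (V \<otimes> W) f"
    by (simp add: hex L_eq_R R_comp R_J K.comp_chain[OF as(1)] nat)
  have l: "?l \<cdot>\<^bsub>K\<^esub> J ?e = \<dots>"
    by (simp add: L_eq_R J_chain[OF Sym_Sym] as(2) K.comp_chain3[OF hex])
  show ?thesis
    by (rule K.cancel_right[OF _ inv]) (use l r in auto)
qed

section \<open>Central Kleisli morphisms: closure properties and comparison with central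
  cones\<close>

lemma central_iff:
  "central C T f \<longleftrightarrow> f \<in> Arr K \<and> (\<forall>f' \<in> Arr K.
     R (Cod K f) f' \<cdot>\<^bsub>K\<^esub> L f (Dom K f') = L f (Cod K f') \<cdot>\<^bsub>K\<^esub> R (Dom K f) f')"
  by (simp add: central_def)

lemma central_J:
  assumes "f \<in> Arr C"
  shows "central C T (J f)"
  using assms by (simp add: central_iff L_J R_natural)

text \<open>The test morphism \<open>f'\<close> is interchanged first with \<open>g\<close> and then
  with \<open>f\<close>.\<close>

lemma central_comp:
  assumes f: "central C T f" and g: "central C T g" and fg [simp]: "Dom K g = Cod K f"
  shows "central C T (g \<cdot>\<^bsub>K\<^esub> f)"
proof -
  have [simp]: "f \<in> Arr K" "g \<in> Arr K" using f g by (auto simp: central_iff)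
  have f': "R (Cod K f) f' \<cdot>\<^bsub>K\<^esub> L f (Dom K f') = L f (Cod K f') \<cdot>\<^bsub>K\<^esub> R (Dom K f) f'"
    and g': "R (Cod K g) f' \<cdot>\<^bsub>K\<^esub> L g (Dom K f') = L g (Cod K f') \<cdot>\<^bsub>K\<^esub> R (Cod K f) f'"
    if "f' \<in> Arr K" for f'
    using f g that by (auto simp: central_iff)
  show ?thesis
    by (auto simp: central_iff L_comp f' K.comp_chain[OF g'])
qed

text \<open>Conjugation by the associator turns the centrality equation for \<open>W \<otimes>\<^sub>r f\<close> into \<open>W \<otimes>\<^sub>r -\<close>
  applied to that for \<open>f\<close>.\<close>

lemma central_R:
  assumes f: "central C T f" and W [simp]: "W \<in> Obj C"
  shows "central C T (R W f)"
  unfolding central_iff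
proof (intro conjI ballI)
  have [simp]: "f \<in> Arr K" using f by (auto simp: central_iff)
  then show "R W f \<in> Arr K" by simp
  fix f' assume f' [simp]: "f' \<in> Arr K"
  let ?X = "Dom K f" and ?Y = "Cod K f" and ?X' = "Dom K f'" and ?Y' = "Cod K f'"
  obtain b where b [simp]: "b \<in> Arr C" "Dom C b = W \<otimes> (?Y \<otimes> ?Y')" "Cod C b = (W \<otimes> ?Y) \<otimes> ?Y'"
    and ba: "b \<cdot> \<alpha> W ?Y ?Y' = \<one> ((W \<otimes> ?Y) \<otimes> ?Y')"
    using Assoc_iso[of W ?Y ?Y'] by (auto simp: iso_arr_def hom_def)
  have inv: "J b \<cdot>\<^bsub>K\<^esub> J (\<alpha> W ?Y ?Y') = \<one>\<^bsub>K\<^esub> ((W \<otimes> ?Y) \<otimes> ?Y')"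
    using arg_cong[OF ba, of J] by simp
  have "R W (R ?Y f' \<cdot>\<^bsub>K\<^esub> L f ?X') = R W (L f ?Y' \<cdot>\<^bsub>K\<^esub> R ?X f')"
    using f by (simp add: central_iff)
  then have eq: "R W (R ?Y f') \<cdot>\<^bsub>K\<^esub> R W (L f ?X') = R W (L f ?Y') \<cdot>\<^bsub>K\<^esub> R W (R ?X f')"
    by (simp add: R_comp)
  have "J (\<alpha> W ?Y ?Y') \<cdot>\<^bsub>K\<^esub> R (W \<otimes> ?Y) f' \<cdot>\<^bsub>K\<^esub> L (R W f) ?X'
      = R W (R ?Y f') \<cdot>\<^bsub>K\<^esub> R W (L f ?X') \<cdot>\<^bsub>K\<^esub> J (\<alpha> W ?X ?X')"
    by (subst K.comp_chain[OF R_assoc]) (simp_all add: L_R_assoc)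
  also have "\<dots> = R W (L f ?Y') \<cdot>\<^bsub>K\<^esub> R W (R ?X f') \<cdot>\<^bsub>K\<^esub> J (\<alpha> W ?X ?X')"
    by (subst K.comp_chain[OF eq]) simp_all
  also have "\<dots> = J (\<alpha> W ?Y ?Y') \<cdot>\<^bsub>K\<^esub> L (R W f) ?Y' \<cdot>\<^bsub>K\<^esub> R (W \<otimes> ?X) f'"
    by (subst K.comp_chain[OF L_R_assoc]) (simp_all add: R_assoc)
  finally have "J (\<alpha> W ?Y ?Y') \<cdot>\<^bsub>K\<^esub> (R (W \<otimes> ?Y) f' \<cdot>\<^bsub>K\<^esub> L (R W f) ?X')
      = J (\<alpha> W ?Y ?Y') \<cdot>\<^bsub>K\<^esub> (L (R W f) ?Y' \<cdot>\<^bsub>K\<^esub> R (W \<otimes> ?X) f')" .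
  then have "R (W \<otimes> ?Y) f' \<cdot>\<^bsub>K\<^esub> L (R W f) ?X' = L (R W f) ?Y' \<cdot>\<^bsub>K\<^esub> R (W \<otimes> ?X) f'"
    by (rule K.cancel_left[OF _ inv]) auto
  then show "R (Cod K (R W f)) f' \<cdot>\<^bsub>K\<^esub> L (R W f) (Dom K f')
      = L (R W f) (Cod K f') \<cdot>\<^bsub>K\<^esub> R (Dom K (R W f)) f'" by simp
qed

text \<open>Centrality quantifies over all Kleisli morphisms, a cone only over objects; the generic
  morphisms \<open>?u V\<close> close the gap. The conjunct on \<open>Y\<close> is explicit because
  \<open>central_cone\<close> does not itself put \<open>Y\<close> among the objects.\<close>

lemma central_iff_central_cone:
  "central C T (X, f, Y) \<longleftrightarrow> Y \<in> Obj C \<and> central_cone C T Y (X, f)"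
proof (cases "X \<in> Obj C \<and> Y \<in> Obj C \<and> f \<in> hom C X (fobj T Y)")
  case False
  then show ?thesis by (auto simp: central_iff central_cone_def hom_def)
next
  case True
  then have [simp]: "X \<in> Obj C" "Y \<in> Obj C" "f \<in> Arr C" "Dom C f = X" "Cod C f = fobj T Y"
    by (auto simp: hom_def)
  let ?f = "(X, f, Y)" and ?u = "\<lambda>V. (fobj T V, \<one> (fobj T V), V)"
  \<comment> \<open>Whiskering the identity \<open>?u V\<close> leaves the bare strength, and
    \<open>str_natural_left\<close> moves \<open>f\<close> across \<open>str\<close> to the right
    end. The two sides of the cone equation appear in exchanged order.\<close>
  have cone: "central_cone C T Y (X, f) \<longleftrightarrow>
    (\<forall>V \<in> Obj C. R Y (?u V) \<cdot>\<^bsub>K\<^esub> L ?f (fobj T V) = L ?f V \<cdot>\<^bsub>K\<^esub> R X (?u V))"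
    by (auto simp: central_cone_def hom_def str_natural_left)
  have "central C T ?f" if *: "central_cone C T Y (X, f)"
    unfolding central_iff
  proof (intro conjI ballI)
    show "?f \<in> Arr K" by simp
    fix f' assume "f' \<in> Arr K"
    then obtain X' f'' V where [simp]: "f' = (X', f'', V)" "X' \<in> Obj C" "V \<in> Obj C"
        "f'' \<in> Arr C" "Dom C f'' = X'" "Cod C f'' = fobj T V"
      by (rule K_cases)
    \<comment> \<open>Every \<open>f'\<close> is a generic morphism precomposed with an arrow of
      \<open>C\<close>. The \<open>J\<close> factor interchanges by \<open>L_natural\<close>, so the
      hypothesis is needed for \<open>?u V\<close> only.\<close>
    have f': "f' = ?u V \<cdot>\<^bsub>K\<^esub> J f''"
      by (simp add: comp_J)
    have nat: "J (\<one> Y \<boxtimes> f'') \<cdot>\<^bsub>K\<^esub> L ?f X' = L ?f (fobj T V) \<cdot>\<^bsub>K\<^esub> J (\<one> X \<boxtimes> f'')"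
      using L_natural[of ?f f'' "fobj T V"] by (simp del: R_L_eq)
    have u: "R Y (?u V) \<cdot>\<^bsub>K\<^esub> L ?f (fobj T V) = L ?f V \<cdot>\<^bsub>K\<^esub> R X (?u V)"
      using * cone by simp
    have "R Y f' \<cdot>\<^bsub>K\<^esub> L ?f X' = L ?f V \<cdot>\<^bsub>K\<^esub> R X f'"
      unfolding f' by (simp add: R_comp R_J nat K.comp_chain[OF u] del: R_L_eq K_Comp)
    then show "R (Cod K ?f) f' \<cdot>\<^bsub>K\<^esub> L ?f (Dom K f') = L ?f (Cod K f') \<cdot>\<^bsub>K\<^esub> R (Dom K ?f) f'"
      by (simp del: R_L_eq K_Comp)
  qed
  moreover have "central_cone C T Y (X, f)" if *: "central C T ?f"
    unfolding cone
  proof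
    fix V assume "V \<in> Obj C"
    then have "?u V \<in> Arr K" by simp
    with * have "R (Cod K ?f) (?u V) \<cdot>\<^bsub>K\<^esub> L ?f (Dom K (?u V)) = L ?f (Cod K (?u V)) \<cdot>\<^bsub>K\<^esub> R (Dom K ?f) (?u V)"
      unfolding central_iff by blast
    then show "R Y (?u V) \<cdot>\<^bsub>K\<^esub> L ?f (fobj T V) = L ?f V \<cdot>\<^bsub>K\<^esub> R X (?u V)"
      by (simp only: K_simps)
  qed
  ultimately show ?thesis by auto
qed

subsection \<open>Terminal central cones are couniversal arrows into the centre\<close>

text \<open>Arrows of \<open>central_cones\<close> are triples whose ends are fixed by the hom-set,
  so unique existence of an arrow is unique existence of its middle component.\<close>

lemma terminal_central_cones_iff:
  "terminal (central_cones C T X) (Z, i) \<longleftrightarrow> central_cone C T X (Z, i) \<and>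
    (\<forall>W f. central_cone C T X (W, f) \<longrightarrow> (\<exists>!g. g \<in> hom C W Z \<and> i \<cdot> g = f))"
proof -
  have hom: "a \<in> hom (central_cones C T X) (W, f) (Z, i) \<longleftrightarrow>
      (\<exists>g. a = ((W, f), g, (Z, i)) \<and> central_cone C T X (W, f) \<and> central_cone C T X (Z, i) \<and>
        g \<in> hom C W Z \<and> i \<cdot> g = f)" for a W f
    by (auto simp: hom_def central_cones_def)
  have Obj: "Obj (central_cones C T X) = {c. central_cone C T X c}"
    by (simp add: central_cones_def)
  have key: "(\<exists>!a. a \<in> hom (central_cones C T X) (W, f) (Z, i)) \<longleftrightarrow> (\<exists>!g. g \<in> hom C W Z \<and> i \<cdot> g = f)"
    if "central_cone C T X (W, f)" "central_cone C T X (Z, i)" for W f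
    unfolding hom using that by (intro iffI; elim ex1E) auto
  have "terminal (central_cones C T X) (Z, i) \<longleftrightarrow> central_cone C T X (Z, i) \<and>
    (\<forall>W f. central_cone C T X (W, f) \<longrightarrow> (\<exists>!a. a \<in> hom (central_cones C T X) (W, f) (Z, i)))"
    by (simp add: terminal_def Obj)
  then show ?thesis using key by blast
qed

lemma centre_simps [simp]:
  "Obj (centre C T) = Obj C" "Arr (centre C T) = {f. central C T f}"
  "Dom (centre C T) = Dom K" "Cod (centre C T) = Cod K"
  "Ident (centre C T) = Ident K" "Comp (centre C T) = Comp K"
  by (simp_all add: centre_def kleisli_def)

lemma central_Arr: "central C T f \<Longrightarrow> f \<in> Arr K"
  by (simp add: central_iff)

lemma hom_centre: "f \<in> hom (centre C T) X Y \<longleftrightarrow> f \<in> hom K X Y \<and> central C T f"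
  by (auto simp: hom_def central_Arr)

lemma category_centre: "category (centre C T)"
proof
  fix f g X Y Z assume "f \<in> hom (centre C T) X Y" "g \<in> hom (centre C T) Y Z"
  then show "g \<cdot>\<^bsub>centre C T\<^esub> f \<in> hom (centre C T) X Z"
    by (auto simp: hom_def central_comp central_Arr)
next
  fix X assume "X \<in> Obj (centre C T)"
  then show "\<one>\<^bsub>centre C T\<^esub> X \<in> hom (centre C T) X X"
    using central_J[of "\<one> X"] by (simp add: hom_def)
qed (auto simp: hom_def central_Arr)

lemma J_centre: "cat_functor C (centre C T) (kleisli_J C T)"
proof -
  interpret Z: category "centre C T" by (rule category_centre)
  show ?thesis by unfold_locales (auto simp: hom_def central_J)
qed

text \<open>Arrows into \<open>Y\<close> in the centre are the central cones at \<open>Y\<close>,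
  and composing \<open>i\<close> with \<open>J f\<close> gives \<open>i \<cdot> f\<close> by
  \<open>comp_J\<close>. Under this translation the two universal properties coincide.\<close>

lemma couniversal_J_iff:
  assumes Y: "Y \<in> Obj C"
  shows "couniversal C (centre C T) (kleisli_J C T) Y Q e \<longleftrightarrow>
    (\<exists>i. e = (Q, i, Y) \<and> terminal (central_cones C T Y) (Q, i))"
proof -
  have hom: "g \<in> hom (centre C T) X Y \<longleftrightarrow> (\<exists>f. g = (X, f, Y) \<and> central_cone C T Y (X, f))" for g X
  proof
    assume "g \<in> hom (centre C T) X Y"
    then show "\<exists>f. g = (X, f, Y) \<and> central_cone C T Y (X, f)"
      using central_iff_central_cone by (cases g) (auto simp: hom_centre hom_def)
  next
    assume "\<exists>f. g = (X, f, Y) \<and> central_cone C T Y (X, f)"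
    then show "g \<in> hom (centre C T) X Y"
      using Y central_iff_central_cone by (auto simp: hom_def)
  qed
  have comp: "(Q, i, Y) \<cdot>\<^bsub>K\<^esub> J f = (X, i \<cdot> f, Y)"
    if "central_cone C T Y (Q, i)" "f \<in> hom C X Q" for i f X
  proof -
    have "(Q, i, Y) \<in> Arr K"
      using that(1) Y central_iff_central_cone central_Arr by blast
    then show ?thesis using that(2) by (auto simp: comp_J hom_def)
  qed
  have "couniversal C (centre C T) (kleisli_J C T) Y Q (Q, i, Y) \<longleftrightarrow>
     terminal (central_cones C T Y) (Q, i)" (is "?l \<longleftrightarrow> ?r") for i
  proof (cases "central_cone C T Y (Q, i)")
    case True
    then have eq: "(f \<in> hom C X Q \<and> (Q, i, Y) \<cdot>\<^bsub>K\<^esub> J f = (X, g, Y))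
       \<longleftrightarrow> (f \<in> hom C X Q \<and> i \<cdot> f = g)" for X f g
      using comp by auto
    have ball_hom: "(\<forall>g \<in> hom (centre C T) X Y. P g) \<longleftrightarrow>
        (\<forall>f. central_cone C T Y (X, f) \<longrightarrow> P (X, f, Y))" for X P
      unfolding Ball_def hom by auto
    have cone_Obj: "X \<in> Obj C" if "central_cone C T Y (X, g)" for X g
      using that by (simp add: central_cone_def)
    have "?l \<longleftrightarrow> (\<forall>X \<in> Obj C. \<forall>g. central_cone C T Y (X, g) \<longrightarrow>
        (\<exists>!f. f \<in> hom C X Q \<and> (Q, i, Y) \<cdot>\<^bsub>K\<^esub> J f = (X, g, Y)))"
      unfolding couniversal_def ball_hom using True cone_Obj[OF True] by (simp add: hom)
    also have "\<dots> \<longleftrightarrow> ?r"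
      unfolding eq terminal_central_cones_iff using True cone_Obj by blast
    finally show ?thesis .
  next
    case False
    then show ?thesis by (simp add: couniversal_def terminal_central_cones_iff hom)
  qed
  moreover have "\<exists>i. e = (Q, i, Y)" if "couniversal C (centre C T) (kleisli_J C T) Y Q e"
    using that by (auto simp: couniversal_def hom)
  ultimately show ?thesis by metis
qed

lemma left_adjoint_J_iff:
  "left_adjoint C (centre C T) (kleisli_J C T) \<longleftrightarrow>
    (\<forall>X \<in> Obj C. \<exists>c. terminal (central_cones C T X) c)"
  unfolding left_adjoint_iff_couniversal[OF J_centre]
  by (auto simp: couniversal_J_iff)

text \<open>Surjectivity of the embedding on arrows gives the factorisation of a cone through
  \<open>\<iota> X\<close>; injectivity gives its uniqueness.\<close>

lemma terminal_if_iso_functor: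
  assumes Z: "strong_monad C Z" and \<iota>: "\<And>X. X \<in> Obj C \<Longrightarrow> \<iota> X \<in> hom C (fobj Z X) (fobj T X)"
    and iso: "iso_functor (kleisli C Z) (centre C T) (kleisli_embedding C \<iota>)"
    and X [simp]: "X \<in> Obj C"
  shows "terminal (central_cones C T X) (fobj Z X, \<iota> X)"
proof -
  interpret Z: strong_monad C Z by fact
  have emb [simp]: "farr (kleisli_embedding C \<iota>) (W, f, Y) = (W, \<iota> Y \<cdot> f, Y)" for W f Y
    by (simp add: kleisli_embedding_def)
  have \<iota>_typing [simp]: "\<iota> X \<in> Arr C" "Dom C (\<iota> X) = fobj Z X" "Cod C (\<iota> X) = fobj T X"
    using \<iota>[OF X] by (auto dest: homD)
  obtain G :: "('o, 'o \<times> 'a \<times> 'o, 'o, 'o \<times> 'a \<times> 'o) func"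
    where G_functor: "cat_functor (centre C T) (kleisli C Z) G"
      and G: "\<And>f. f \<in> Arr (kleisli C Z) \<Longrightarrow> farr G (farr (kleisli_embedding C \<iota>) f) = f"
      and G': "\<And>g. g \<in> Arr (centre C T) \<Longrightarrow> farr (kleisli_embedding C \<iota>) (farr G g) = g"
    using iso unfolding iso_functor_def by blast
  interpret G: cat_functor "centre C T" "kleisli C Z" G by (rule G_functor)
  interpret I: cat_functor "kleisli C Z" "centre C T" "kleisli_embedding C \<iota>"
    using iso by (simp add: iso_functor_def)
  \<comment> \<open>The identity of \<open>fobj Z X\<close>, regarded as a Kleisli morphism of
    \<open>Z\<close> into \<open>X\<close>, is sent to \<open>\<iota> X\<close>, which is thereby
    central.\<close>
  have cone: "central_cone C T X (fobj Z X, \<iota> X)"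
    using I.farr_typing(1)[of "(fobj Z X, \<one> (fobj Z X), X)"] by (simp add: central_iff_central_cone)
  show ?thesis
    unfolding terminal_central_cones_iff
  proof (intro conjI cone allI impI ex_ex1I)
    fix W f assume f: "central_cone C T X (W, f)"
    then have c: "(W, f, X) \<in> Arr (centre C T)" by (simp add: central_iff_central_cone)
    show "\<exists>g. g \<in> hom C W (fobj Z X) \<and> \<iota> X \<cdot> g = f"
      using G'[OF c] G.farr_typing(1)[OF c] by (cases "farr G (W, f, X)") (auto simp: hom_def)
  next
    fix W f g g'
    assume "g \<in> hom C W (fobj Z X) \<and> \<iota> X \<cdot> g = f" "g' \<in> hom C W (fobj Z X) \<and> \<iota> X \<cdot> g' = f"
    then have g: "(W, g, X) \<in> Arr (kleisli C Z)" "(W, g', X) \<in> Arr (kleisli C Z)"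
      and eq: "\<iota> X \<cdot> g = \<iota> X \<cdot> g'"
      by (auto simp: hom_def)
    show "g = g'"
      using G[OF g(1), unfolded emb] G[OF g(2), unfolded emb] unfolding eq by simp
  qed
qed

end

subsection \<open>The central submonad\<close>

locale terminal_central_cones = strong_monad C T
  for C :: "('o, 'a, 'm) smc_scheme" (structure) and T :: "('o, 'a) smonad" +
  fixes Zo :: "'o \<Rightarrow> 'o" and i :: "'o \<Rightarrow> 'a"
  assumes terminal: "X \<in> Obj C \<Longrightarrow> terminal (central_cones C T X) (Zo X, i X)"
begin

text \<open>Centrality of an arrow of \<open>C\<close> viewed as a Kleisli morphism. The target
  \<open>X\<close> is a parameter because \<open>fobj T X\<close> need not determine it.\<close>

definition "central_at X f \<longleftrightarrow> central C T (Dom C f, f, X)"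

lemma central_at_typing:
  assumes "central_at X f"
  shows "X \<in> Obj C" "f \<in> Arr C" "Cod C f = fobj T X"
  using assms central_Arr[of "(Dom C f, f, X)"] by (auto simp: central_at_def)

lemma i_typing [simp]:
  assumes "X \<in> Obj C"
  shows "Zo X \<in> Obj C" "i X \<in> Arr C" "Dom C (i X) = Zo X" "Cod C (i X) = fobj T X"
  using terminal[OF assms] by (auto simp: terminal_central_cones_iff central_cone_def hom_def)

lemma central_at_i: "X \<in> Obj C \<Longrightarrow> central_at X (i X)"
  using terminal[of X] by (simp add: central_at_def central_iff_central_cone terminal_central_cones_iff)

text \<open>Precomposition in \<open>C\<close> is Kleisli composition with \<open>J g\<close>. This
  and the next four lemmas make the composites that define \<open>Z\<close> central:
  \<open>farr T g\<close> is \<open>J g\<close> on the other side, \<open>mu\<close> comes from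
  Kleisli composition, \<open>str\<close> from \<open>central_R\<close>.\<close>

lemma central_at_comp:
  assumes "central_at X f" "g \<in> Arr C" "Cod C g = Dom C f"
  shows "central_at X (f \<cdot> g)"
  using central_comp[OF central_J[of g], of "(Dom C f, f, X)"] assms central_at_typing[OF assms(1)]
  by (simp add: central_at_def comp_J del: K_Comp)

lemma central_at_T:
  assumes "central_at (Dom C g) f" "g \<in> Arr C" "Cod C g = Y"
  shows "central_at Y (farr T g \<cdot> f)"
  using central_comp[OF _ central_J[of g], of "(Dom C f, f, Dom C g)"] assms central_at_typing[OF assms(1)]
  by (simp add: central_at_def J_comp del: K_Comp)

lemma central_at_eta: "X \<in> Obj C \<Longrightarrow> central_at X (eta T X)"
  using central_J[of "\<one> X"] by (simp add: central_at_def J_eq)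

lemma central_at_mu:
  assumes "central_at X f" "central_at (Dom C f) g"
  shows "central_at X (mu T X \<cdot> farr T f \<cdot> g)"
  using central_comp[of "(Dom C g, g, Dom C f)" "(Dom C f, f, X)"] assms central_at_typing[OF assms(1)] central_at_typing[OF assms(2)]
  by (simp add: central_at_def)

lemma central_at_str:
  assumes "central_at Y f" "W \<in> Obj C"
  shows "central_at (W \<otimes> Y) (str T W Y \<cdot> (\<one> W \<boxtimes> f))"
  using central_R[of "(Dom C f, f, Y)" W] assms central_at_typing[OF assms(1)]
  by (simp add: central_at_def)

text \<open>The mediating arrow into the chosen terminal cone, specified only when
  \<open>central_at X f\<close> holds.\<close>

definition "lift X f = (THE g. g \<in> hom C (Dom C f) (Zo X) \<and> i X \<cdot> g = f)"

lemma lift: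
  assumes "central_at X f"
  shows "lift X f \<in> Arr C" "Dom C (lift X f) = Dom C f" "Cod C (lift X f) = Zo X"
    and "i X \<cdot> lift X f = f"
proof -
  have "\<exists>!g. g \<in> hom C (Dom C f) (Zo X) \<and> i X \<cdot> g = f"
    using terminal[of X] assms
    by (simp add: central_at_def central_iff_central_cone terminal_central_cones_iff)
  from theI'[OF this] show "lift X f \<in> Arr C" "Dom C (lift X f) = Dom C f"
    "Cod C (lift X f) = Zo X" "i X \<cdot> lift X f = f"
    by (auto simp: lift_def hom_def)
qed

text \<open>The composite \<open>i X \<cdot> f\<close> is central again, so \<open>f\<close> and
  \<open>g\<close> mediate the same cone. Thus \<open>i X\<close> is monic, and laws of
  \<open>Z\<close> may be checked after composing with it.\<close>

lemma i_eqI: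
  assumes "i X \<cdot> f = i X \<cdot> g" "X \<in> Obj C" "f \<in> Arr C" "g \<in> Arr C"
    "Dom C f = Dom C g" "Cod C f = Zo X" "Cod C g = Zo X"
  shows "f = g"
proof -
  have "central_at X (i X \<cdot> f)" using assms by (intro central_at_comp central_at_i) auto
  then have "\<exists>!h. h \<in> hom C (Dom C f) (Zo X) \<and> i X \<cdot> h = i X \<cdot> f"
    using terminal[of X] assms
    by (simp add: central_at_def central_iff_central_cone terminal_central_cones_iff)
  then show ?thesis using assms by (auto simp: hom_def)
qed

text \<open>Each operation is the unique lift that makes \<open>i\<close> natural and a morphism of
  strong monads. The arrow lifted for \<open>mu\<close> is the Kleisli composite of
  \<open>i X\<close> with \<open>i (Zo X)\<close>.\<close>

definition Z :: "('o, 'a) smonad" where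
  "Z = \<lparr>fobj = Zo, farr = (\<lambda>f. lift (Cod C f) (farr T f \<cdot> i (Dom C f))),
     eta = (\<lambda>X. lift X (eta T X)), mu = (\<lambda>X. lift X (mu T X \<cdot> farr T (i X) \<cdot> i (Zo X))),
     str = (\<lambda>X Y. lift (X \<otimes> Y) (str T X Y \<cdot> (\<one> X \<boxtimes> i Y)))\<rparr>"

lemma fobj_Z [simp]: "fobj Z X = Zo X"
  by (simp add: Z_def)

lemma Z_typing [simp]:
  "f \<in> Arr C \<Longrightarrow> farr Z f \<in> Arr C"
  "f \<in> Arr C \<Longrightarrow> Dom C (farr Z f) = Zo (Dom C f)"
  "f \<in> Arr C \<Longrightarrow> Cod C (farr Z f) = Zo (Cod C f)"
  "X \<in> Obj C \<Longrightarrow> eta Z X \<in> Arr C"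
  "X \<in> Obj C \<Longrightarrow> Dom C (eta Z X) = X"
  "X \<in> Obj C \<Longrightarrow> Cod C (eta Z X) = Zo X"
  "X \<in> Obj C \<Longrightarrow> mu Z X \<in> Arr C"
  "X \<in> Obj C \<Longrightarrow> Dom C (mu Z X) = Zo (Zo X)"
  "X \<in> Obj C \<Longrightarrow> Cod C (mu Z X) = Zo X"
  "X \<in> Obj C \<Longrightarrow> Y \<in> Obj C \<Longrightarrow> str Z X Y \<in> Arr C"
  "X \<in> Obj C \<Longrightarrow> Y \<in> Obj C \<Longrightarrow> Dom C (str Z X Y) = X \<otimes> Zo Y"
  "X \<in> Obj C \<Longrightarrow> Y \<in> Obj C \<Longrightarrow> Cod C (str Z X Y) = Zo (X \<otimes> Y)"
  by (simp_all add: Z_def lift central_at_T central_at_i central_at_eta central_at_mu central_at_str)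

lemma i_Z:
  "f \<in> Arr C \<Longrightarrow> Cod C f = Y \<Longrightarrow> i Y \<cdot> farr Z f = farr T f \<cdot> i (Dom C f)"
  "X \<in> Obj C \<Longrightarrow> i X \<cdot> eta Z X = eta T X"
  "X \<in> Obj C \<Longrightarrow> i X \<cdot> mu Z X = mu T X \<cdot> farr T (i X) \<cdot> i (Zo X)"
  "X \<in> Obj C \<Longrightarrow> Y \<in> Obj C \<Longrightarrow> i (X \<otimes> Y) \<cdot> str Z X Y = str T X Y \<cdot> (\<one> X \<boxtimes> i Y)"
  by (auto simp: Z_def lift central_at_T central_at_i central_at_eta central_at_mu central_at_str)

text \<open>As rewrite rules these push \<open>i\<close> to the right, replacing operations of
  \<open>Z\<close> by those of \<open>T\<close> on the way.\<close>

lemma i_Z_chain: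
  "f \<in> Arr C \<Longrightarrow> Cod C f = Y \<Longrightarrow> k \<in> Arr C \<Longrightarrow> Cod C k = Zo (Dom C f) \<Longrightarrow>
    i Y \<cdot> farr Z f \<cdot> k = farr T f \<cdot> i (Dom C f) \<cdot> k"
  "X \<in> Obj C \<Longrightarrow> k \<in> Arr C \<Longrightarrow> Cod C k = X \<Longrightarrow> i X \<cdot> eta Z X \<cdot> k = eta T X \<cdot> k"
  "X \<in> Obj C \<Longrightarrow> k \<in> Arr C \<Longrightarrow> Cod C k = Zo (Zo X) \<Longrightarrow>
    i X \<cdot> mu Z X \<cdot> k = mu T X \<cdot> farr T (i X) \<cdot> i (Zo X) \<cdot> k"
  "X \<in> Obj C \<Longrightarrow> Y \<in> Obj C \<Longrightarrow> k \<in> Arr C \<Longrightarrow> Cod C k = X \<otimes> Zo Y \<Longrightarrow>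
    i (X \<otimes> Y) \<cdot> str Z X Y \<cdot> k = str T X Y \<cdot> (\<one> X \<boxtimes> i Y) \<cdot> k"
  using comp_chain[OF i_Z(1), of f Y k] comp_chain[OF i_Z(2), of X k] comp_chain[OF i_Z(3), of X k]
    comp_chain[OF i_Z(4), of X Y k] by auto

text \<open>Carries the equations \<open>i_Z\<close> under \<open>T\<close>, where the lift defining
  \<open>mu\<close> places an \<open>i X\<close>.\<close>

lemma farr_T_comp_eq:
  "f \<cdot> g = h \<Longrightarrow> f \<in> Arr C \<Longrightarrow> g \<in> Arr C \<Longrightarrow> Dom C f = Cod C g \<Longrightarrow> farr T f \<cdot> farr T g = farr T h"
  by auto

lemma Z_functor: "cat_functor C C Z"
proof
  fix f g U V W assume "f \<in> hom C U V" "g \<in> hom C V W"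
  then have [simp]: "f \<in> Arr C" "Dom C f = U" "Cod C f = V" "U \<in> Obj C" "V \<in> Obj C"
    "g \<in> Arr C" "Dom C g = V" "Cod C g = W" "W \<in> Obj C" by (auto dest: homD hom_Obj)
  show "farr Z (g \<cdot> f) = farr Z g \<cdot> farr Z f"
    by (rule i_eqI[of W]) (auto simp: i_Z i_Z_chain)
next
  fix X assume "X \<in> Obj C"
  then show "farr Z (\<one> X) = \<one> (fobj Z X)"
    by - (rule i_eqI[of X], auto simp: i_Z)
qed (auto simp: hom_def)

lemma Lunit_natural: "f \<in> Arr C \<Longrightarrow> Cod C f = X \<Longrightarrow> \<l> X \<cdot> (\<one> \<I> \<boxtimes> f) = f \<cdot> \<l> (Dom C f)"
  by (rule Lunit_nat) (simp add: hom_def)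

text \<open>For each law both sides are composed with \<open>i\<close>, turned into operations of
  \<open>T\<close> by \<open>i_Z\<close>, and compared by the matching law of \<open>T\<close>;
  \<open>i_eqI\<close> removes \<open>i\<close> again.\<close>

lemma strong_monad_Z: "strong_monad C Z"
proof -
  interpret F: cat_functor C C Z by (rule Z_functor)
  interpret I: cat_functor C C id_func by (rule cat_functor_id_func[OF category_axioms])
  interpret ZZ: cat_functor C C "comp_func Z Z" by (rule cat_functor_comp_func[OF Z_functor Z_functor])
  have T_i_mu: "farr T (i X) \<cdot> farr T (mu Z X) = farr T (mu T X) \<cdot> farr T (farr T (i X)) \<cdot> farr T (i (Zo X))"
    if "X \<in> Obj C" for X
    using that farr_T_comp_eq[OF i_Z(3)[OF that]] by simp
  have T_i_str: "farr T (i (X \<otimes> Y)) \<cdot> farr T (str Z X Y) = farr T (str T X Y) \<cdot> farr T (\<one> X \<boxtimes> i Y)"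
    if "X \<in> Obj C" "Y \<in> Obj C" for X Y
    using that farr_T_comp_eq[OF i_Z(4)[OF that]] by simp
  have T_i_eta: "farr T (i X) \<cdot> farr T (eta Z X) = farr T (eta T X)"
    if "X \<in> Obj C" for X
    using that farr_T_comp_eq[OF i_Z(2)[OF that]] by simp
  have T_i_farr: "farr T (i Y) \<cdot> farr T (farr Z f) = farr T (farr T f) \<cdot> farr T (i (Dom C f))"
    if "f \<in> Arr C" "Cod C f = Y" for f Y
    using that farr_T_comp_eq[OF i_Z(1)[OF that]] by auto
  show ?thesis
  proof
    fix X Y f assume "f \<in> hom C X Y"
    then have [simp]: "f \<in> Arr C" "Dom C f = X" "Cod C f = Y" "X \<in> Obj C" "Y \<in> Obj C"
      by (auto dest: homD hom_Obj)
    show "eta Z Y \<cdot> farr id_func f = farr Z f \<cdot> eta Z X"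
      by (rule i_eqI[of Y]) (auto simp: i_Z i_Z_chain eta_natural)
    show "mu Z Y \<cdot> farr (comp_func Z Z) f = farr Z f \<cdot> mu Z X"
      by (rule i_eqI[of Y]) (auto simp: i_Z i_Z_chain comp_chain[OF mu_natural] comp_chain[OF T_i_farr])
  next
    fix X assume [simp]: "X \<in> Obj C"
    show "mu Z X \<cdot> eta Z (fobj Z X) = \<one> (fobj Z X)"
      using mu_T_eta[of "i X" X]
      by - (rule i_eqI[of X], auto simp: i_Z i_Z_chain)
    show "mu Z X \<cdot> farr Z (eta Z X) = \<one> (fobj Z X)"
      by - (rule i_eqI[of X], auto simp: i_Z i_Z_chain comp_chain[OF T_i_eta] comp_chain[OF mu_eta_right])
    show "mu Z X \<cdot> mu Z (fobj Z X) = mu Z X \<cdot> farr Z (mu Z X)"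
      by - (rule i_eqI[of X],
         auto simp: i_Z i_Z_chain comp_chain[OF T_i_mu] comp_chain[OF mu_natural] comp_chain[OF mu_mu[symmetric]])
  next
    fix f g X X' Y Y' assume "f \<in> hom C X X'" "g \<in> hom C Y Y'"
    then have [simp]: "f \<in> Arr C" "Dom C f = X" "Cod C f = X'" "X \<in> Obj C" "X' \<in> Obj C"
      "g \<in> Arr C" "Dom C g = Y" "Cod C g = Y'" "Y \<in> Obj C" "Y' \<in> Obj C"
      by (auto dest: homD hom_Obj)
    have "farr T (f \<boxtimes> g) \<cdot> str T X Y \<cdot> (\<one> X \<boxtimes> i Y) = str T X' Y' \<cdot> (f \<boxtimes> farr T g) \<cdot> (\<one> X \<boxtimes> i Y)"
      using comp_chain[OF str_natural[of f g X' Y'], of "\<one> X \<boxtimes> i Y"] by simp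
    then show "str Z X' Y' \<cdot> (f \<boxtimes> farr Z g) = farr Z (f \<boxtimes> g) \<cdot> str Z X Y"
      by - (rule i_eqI[of "X' \<otimes> Y'"], auto simp: i_Z i_Z_chain Tarr_comp)
  next
    fix X assume [simp]: "X \<in> Obj C"
    show "farr Z (\<l> X) \<cdot> str Z \<I> X = \<l> (fobj Z X)"
      by - (rule i_eqI[of X], auto simp: i_Z i_Z_chain comp_chain[OF str_Lunit] Lunit_natural)
  next
    fix X Y W assume [simp]: "X \<in> Obj C" "Y \<in> Obj C" "W \<in> Obj C"
    have 1: "(\<one> X \<boxtimes> i (Y \<otimes> W)) \<cdot> (\<one> X \<boxtimes> str Z Y W) = (\<one> X \<boxtimes> str T Y W) \<cdot> (\<one> X \<boxtimes> (\<one> Y \<boxtimes> i W))"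
      by (simp add: Tarr_comp i_Z)
    have 2: "(\<one> X \<boxtimes> (\<one> Y \<boxtimes> i W)) \<cdot> \<alpha> X Y (Zo W) = \<alpha> X Y (fobj T W) \<cdot> (\<one> (X \<otimes> Y) \<boxtimes> i W)"
      using Assoc_natural[of "\<one> X" "\<one> Y" "i W" X Y "fobj T W"] by simp
    show "farr Z (\<alpha> X Y W) \<cdot> str Z (X \<otimes> Y) W = str Z X (Y \<otimes> W) \<cdot> (\<one> X \<boxtimes> str Z Y W) \<cdot> \<alpha> X Y (fobj Z W)"
      by - (rule i_eqI[of "X \<otimes> (Y \<otimes> W)"], auto simp: i_Z i_Z_chain comp_chain[OF 1] 2 comp_chain[OF str_Assoc])
  next
    fix X Y assume [simp]: "X \<in> Obj C" "Y \<in> Obj C"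
    show "str Z X Y \<in> hom C (X \<otimes> fobj Z Y) (fobj Z (X \<otimes> Y))" by (simp add: hom_def)
    show "str Z X Y \<cdot> (\<one> X \<boxtimes> eta Z Y) = eta Z (X \<otimes> Y)"
      by - (rule i_eqI[of "X \<otimes> Y"], auto simp: i_Z i_Z_chain Tarr_comp str_eta)
    have 1: "(\<one> X \<boxtimes> i Y) \<cdot> (\<one> X \<boxtimes> mu Z Y)
        = (\<one> X \<boxtimes> mu T Y) \<cdot> (\<one> X \<boxtimes> farr T (i Y)) \<cdot> (\<one> X \<boxtimes> i (Zo Y))"
      by (simp add: Tarr_comp i_Z)
    have 2: "str T X (fobj T Y) \<cdot> (\<one> X \<boxtimes> farr T (i Y)) = farr T (\<one> X \<boxtimes> i Y) \<cdot> str T X (Zo Y)"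
      using str_natural[of "\<one> X" "i Y" X "fobj T Y"] by simp
    show "str Z X Y \<cdot> (\<one> X \<boxtimes> mu Z Y) = mu Z (X \<otimes> Y) \<cdot> farr Z (str Z X Y) \<cdot> str Z X (fobj Z Y)"
      by - (rule i_eqI[of "X \<otimes> Y"],
         auto simp: i_Z i_Z_chain 1 comp_chain[OF 2] comp_chain[OF T_i_str] comp_chain[OF str_mu])
  qed (auto simp: hom_def)
qed

lemma strong_monad_morphism_i: "strong_monad_morphism C Z T i"
proof -
  interpret Z: strong_monad C Z by (rule strong_monad_Z)
  show ?thesis
    by unfold_locales (auto simp: hom_def i_Z)
qed

text \<open>The monomorphism condition holds componentwise, by cancelling
  \<open>i X\<close>.\<close>

lemma strong_submonad_Z: "strong_submonad C T Z i"
  unfolding strong_submonad_def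
proof (intro conjI strong_monad_morphism_i allI impI ballI)
  fix Q \<kappa> \<kappa>' X
  assume *: "strong_monad_morphism C Q Z \<kappa> \<and> strong_monad_morphism C Q Z \<kappa>' \<and>
      (\<forall>X\<in>Obj C. i X \<cdot> \<kappa> X = i X \<cdot> \<kappa>' X)" and X: "X \<in> Obj C"
  interpret k: strong_monad_morphism C Q Z \<kappa> using * by blast
  interpret k': strong_monad_morphism C Q Z \<kappa>' using * by blast
  show "\<kappa> X = \<kappa>' X"
    using * X k.component_hom[OF X] k'.component_hom[OF X] by - (rule i_eqI[of X], auto simp: hom_def)
qed

text \<open>Centrality of \<open>i X\<close> is the commutativity equation of \<open>T\<close>
  restricted along \<open>i X\<close> in the first variable; restricting along \<open>i Y\<close> in
  the second gives the equation for \<open>Z\<close> composed with \<open>i\<close>.\<close>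

lemma commutative_Z: "commutative C Z"
  unfolding commutative_def
proof (intro ballI)
  interpret Z: strong_monad C Z by (rule strong_monad_Z)
  fix X Y assume [simp]: "X \<in> Obj C" "Y \<in> Obj C"
  have rstr_typing [simp]: "rstr C Z X Y \<in> Arr C" "Dom C (rstr C Z X Y) = Zo X \<otimes> Y"
    "Cod C (rstr C Z X Y) = Zo (X \<otimes> Y)" if "X \<in> Obj C" "Y \<in> Obj C" for X Y
    using Z.rstr_typing[OF that] by auto
  \<comment> \<open>Compatibility of \<open>i\<close> with the right strength, obtained from that
    with \<open>str\<close> by naturality of the symmetry.\<close>
  have i_rstr: "i (X \<otimes> Y) \<cdot> rstr C Z X Y = rstr C T X Y \<cdot> (i X \<boxtimes> \<one> Y)"
    if [simp]: "X \<in> Obj C" "Y \<in> Obj C" for X Y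
    using Sym_natural[of "i X" "\<one> Y" "fobj T X" Y]
    by (simp add: rstr_def i_Z i_Z_chain)
  \<comment> \<open>Naturality of the right strength of \<open>T\<close> in the argument not under
    \<open>T\<close>.\<close>
  have rstr_i: "rstr C T X (fobj T Y) \<cdot> (\<one> (fobj T X) \<boxtimes> i Y) = farr T (\<one> X \<boxtimes> i Y) \<cdot> rstr C T X (Zo Y)"
  proof -
    have "farr T (\<gamma> (fobj T Y) X) \<cdot> farr T (i Y \<boxtimes> \<one> X) = farr T (\<one> X \<boxtimes> i Y) \<cdot> farr T (\<gamma> (Zo Y) X)"
      using farr_T_comp_eq[OF Sym_natural[of "i Y" "\<one> X" "fobj T Y" X]] by simp
    from comp_chain[OF this] show ?thesis
      by (simp add: rstr_def Sym_natural comp_chain[OF str_natural_left])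
  qed
  let ?l = "mu T (X \<otimes> Y) \<cdot> farr T (rstr C T X Y) \<cdot> str T (fobj T X) Y \<cdot> (i X \<boxtimes> \<one> (fobj T Y))"
  let ?r = "mu T (X \<otimes> Y) \<cdot> farr T (str T X Y) \<cdot> rstr C T X (fobj T Y) \<cdot> (i X \<boxtimes> \<one> (fobj T Y))"
  have "?l = ?r"
    using central_at_i[of X] by (simp add: central_at_def central_iff_central_cone central_cone_def)
  then have eq: "?l \<cdot> (\<one> (Zo X) \<boxtimes> i Y) = ?r \<cdot> (\<one> (Zo X) \<boxtimes> i Y)"
    by simp
  have l: "i (X \<otimes> Y) \<cdot> mu Z (X \<otimes> Y) \<cdot> farr Z (rstr C Z X Y) \<cdot> str Z (Zo X) Y = ?l \<cdot> (\<one> (Zo X) \<boxtimes> i Y)"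
    using comp_chain[OF farr_T_comp_eq[OF i_rstr[of X Y]], of "str T (Zo X) Y \<cdot> (\<one> (Zo X) \<boxtimes> i Y)"]
       comp_chain[OF str_natural_left[of "i X" "fobj T X" Y], of "\<one> (Zo X) \<boxtimes> i Y"]
    by (simp add: i_Z i_Z_chain)
  have "i (X \<otimes> Y) \<cdot> mu Z (X \<otimes> Y) \<cdot> farr Z (str Z X Y) \<cdot> rstr C Z X (Zo Y)
      = mu T (X \<otimes> Y) \<cdot> farr T (str T X Y) \<cdot> rstr C T X (fobj T Y) \<cdot> (i X \<boxtimes> i Y)"
    using comp_chain[OF farr_T_comp_eq[OF i_Z(4)[of X Y]], of "rstr C T X (Zo Y) \<cdot> (i X \<boxtimes> \<one> (Zo Y))"]
      comp_chain[OF rstr_i, of "i X \<boxtimes> \<one> (Zo Y)"]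
    by (simp add: i_Z i_Z_chain i_rstr Tarr_comp)
  then have r: "i (X \<otimes> Y) \<cdot> mu Z (X \<otimes> Y) \<cdot> farr Z (str Z X Y) \<cdot> rstr C Z X (Zo Y) = ?r \<cdot> (\<one> (Zo X) \<boxtimes> i Y)"
    by (simp add: Tarr_comp)
  show "mu Z (X \<otimes> Y) \<cdot> farr Z (rstr C Z X Y) \<cdot> str Z (fobj Z X) Y
      = mu Z (X \<otimes> Y) \<cdot> farr Z (str Z X Y) \<cdot> rstr C Z X (fobj Z Y)"
    by (rule i_eqI[of "X \<otimes> Y"]) (use l r eq in auto)
qed

text \<open>The inverse lifts every central arrow through its terminal cone. Lifts exist and are
  unique, so the embedding is bijective on arrows, and the inverse inherits functoriality from
  it.\<close>

lemma iso_functor_embedding: "iso_functor (kleisli C Z) (centre C T) (kleisli_embedding C i)"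
proof -
  interpret Z: strong_monad C Z by (rule strong_monad_Z)
  interpret KZ: category "kleisli C Z" by (rule Z.category_K)
  interpret ZT: category "centre C T" by (rule category_centre)
  have emb [simp]: "fobj (kleisli_embedding C i) X = X"
    "farr (kleisli_embedding C i) (W, f, Y) = (W, i Y \<cdot> f, Y)" for W f X Y
    by (simp_all add: kleisli_embedding_def)
  have central_at_iff: "central C T (W, f, Y) \<longleftrightarrow> central_at Y f \<and> Dom C f = W" for W f Y
    using central_Arr[of "(W, f, Y)"] by (auto simp: central_at_def)
  define G :: "('o, 'o \<times> 'a \<times> 'o, 'o, 'o \<times> 'a \<times> 'o) func"
    where "G = \<lparr>fobj = (\<lambda>X. X), farr = (\<lambda>(W, f, Y). (W, lift Y f, Y))\<rparr>"
  have G [simp]: "fobj G X = X" "farr G (W, f, Y) = (W, lift Y f, Y)" for W f X Y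
    by (simp_all add: G_def)
  interpret I: cat_functor "kleisli C Z" "centre C T" "kleisli_embedding C i"
  proof
    fix f X Y assume "f \<in> hom (kleisli C Z) X Y"
    then show "farr (kleisli_embedding C i) f
       \<in> hom (centre C T) (fobj (kleisli_embedding C i) X) (fobj (kleisli_embedding C i) Y)"
      by (cases f) (auto simp: hom_def central_at_iff central_at_comp central_at_i)
  next
    fix f g U V W assume "f \<in> hom (kleisli C Z) U V" "g \<in> hom (kleisli C Z) V W"
    then obtain f' g' where [simp]: "f = (U, f', V)" "f' \<in> Arr C" "Dom C f' = U" "Cod C f' = Zo V"
      "U \<in> Obj C" "V \<in> Obj C" "g = (V, g', W)" "g' \<in> Arr C" "Dom C g' = V" "Cod C g' = Zo W" "W \<in> Obj C"
      by (cases f; cases g) (auto simp: hom_def)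
    show "farr (kleisli_embedding C i) (g \<cdot>\<^bsub>kleisli C Z\<^esub> f)
      = farr (kleisli_embedding C i) g \<cdot>\<^bsub>centre C T\<^esub> farr (kleisli_embedding C i) f"
      by (simp add: i_Z_chain)
  qed (auto simp: K_Ident Z.K_Ident i_Z)
  have IG: "farr (kleisli_embedding C i) (farr G g) = g" if "g \<in> Arr (centre C T)" for g
    using that by (cases g) (auto simp: central_at_iff lift)
  have G_Arr: "farr G g \<in> Arr (kleisli C Z)" if "g \<in> Arr (centre C T)" for g
    using that by (cases g) (auto simp: central_at_iff lift dest: central_at_typing)
  have inj: "f = f'" if "farr (kleisli_embedding C i) f = farr (kleisli_embedding C i) f'"
    "f \<in> Arr (kleisli C Z)" "f' \<in> Arr (kleisli C Z)" for f f'
    using that by (cases f; cases f') (auto intro: i_eqI[rotated])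
  have GI: "farr G (farr (kleisli_embedding C i) f) = f" if "f \<in> Arr (kleisli C Z)" for f
    by (rule inj[OF IG[OF I.farr_typing(1)[OF that]] G_Arr[OF I.farr_typing(1)[OF that]] that])
  interpret G: cat_functor "centre C T" "kleisli C Z" G
  proof
    fix g X Y assume "g \<in> hom (centre C T) X Y"
    then show "farr G g \<in> hom (kleisli C Z) (fobj G X) (fobj G Y)"
      using G_Arr[of g] by (cases g) (auto simp: hom_def)
  next
    fix X assume "X \<in> Obj (centre C T)"
    then show "farr G (\<one>\<^bsub>centre C T\<^esub> X) = \<one>\<^bsub>kleisli C Z\<^esub> (fobj G X)"
      using GI[of "\<one>\<^bsub>kleisli C Z\<^esub> X"] by (simp add: K_Ident Z.K_Ident i_Z)
  next
    fix f g U V W assume f: "f \<in> hom (centre C T) U V" and g: "g \<in> hom (centre C T) V W"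
    \<comment> \<open>The embedding sends \<open>?k\<close> to the composite of \<open>g\<close> and
      \<open>f\<close>, so applying \<open>G\<close> to that composite recovers
      \<open>?k\<close>.\<close>
    let ?k = "farr G g \<cdot>\<^bsub>kleisli C Z\<^esub> farr G f"
    have Gf: "farr G f \<in> hom (kleisli C Z) U V" "farr G g \<in> hom (kleisli C Z) V W"
      using f g G_Arr[of f] G_Arr[of g] by (cases f; cases g; auto simp: hom_def)+
    then have "farr (kleisli_embedding C i) ?k = g \<cdot>\<^bsub>centre C T\<^esub> f"
      using f g IG[of f] IG[of g] I.farr_Comp[OF Gf] by (simp add: hom_def)
    then show "farr G (g \<cdot>\<^bsub>centre C T\<^esub> f) = ?k"
      using GI[of ?k] KZ.Comp_hom[OF Gf] by (simp add: hom_def)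
  qed simp
  show ?thesis
    unfolding iso_functor_def
    by (intro conjI exI[of _ G] ballI I.cat_functor_axioms G.cat_functor_axioms) (auto simp: GI IG)
qed

end

section \<open>Equivalence of terminal cones, the commutative central submonad and a right adjoint
  to the corestricted \<open>J\<close>\<close>

theorem mainTheorem8:
  fixes C :: "('o, 'a) smc" and T :: "('o, 'a) smonad"
  assumes "symmetric_monoidal_category C"
    and "strong_monad C T"
  shows "((\<forall>X \<in> Obj C. \<exists>c. terminal (central_cones C T X) c) \<longleftrightarrow>
          (\<exists>Z \<iota>. strong_submonad C T Z \<iota> \<and> commutative C Z \<and>
             iso_functor (kleisli C Z) (centre C T) (kleisli_embedding C \<iota>))) \<and>
         ((\<exists>Z \<iota>. strong_submonad C T Z \<iota> \<and> commutative C Z \<and>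
             iso_functor (kleisli C Z) (centre C T) (kleisli_embedding C \<iota>)) \<longleftrightarrow>
          left_adjoint C (centre C T) (kleisli_J C T))"
    (is "(?cones \<longleftrightarrow> ?submonad) \<and> (?submonad \<longleftrightarrow> ?adjoint)")
proof -
  interpret strong_monad C T by fact
  have "?cones \<longleftrightarrow> ?submonad"
  proof
    assume ?cones
    \<comment> \<open>Cones are pairs; splitting them lets choice supply \<open>Zo\<close> and
      \<open>i\<close> as separate functions.\<close>
    then have "\<forall>X \<in> Obj C. \<exists>Z i. terminal (central_cones C T X) (Z, i)"
      by simp
    then obtain Zo i where "\<And>X. X \<in> Obj C \<Longrightarrow> terminal (central_cones C T X) (Zo X, i X)"
      by metis
    then interpret terminal_central_cones C T Zo i by unfold_locales
    show ?submonad
      using strong_submonad_Z commutative_Z iso_functor_embedding by blast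
  next
    assume ?submonad
    then obtain Z \<iota> where Z: "strong_monad_morphism C Z T \<iota>"
      and iso: "iso_functor (kleisli C Z) (centre C T) (kleisli_embedding C \<iota>)"
      by (auto simp: strong_submonad_def)
    interpret Z: strong_monad_morphism C Z T \<iota> by fact
    show ?cones
      using terminal_if_iso_functor[OF Z.source.strong_monad_axioms Z.component_hom iso] by blast
  qed
  then show ?thesis using left_adjoint_J_iff by simp
qed

end
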